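(* Let target rates $\mathcal I^0_l>0$, $l=1,\dots,L$, and a sum power $P_T>0$ be given. The optimal value of $$\textbf{FOP}:\ \max_{\Sigma_{1:L}}\ \min_{1\le l\le L}\frac{\mathcal I_l(\Sigma_{1:L},\Phi)}{\mathcal I^0_l}\quad\text{s.t. }\Sigma_l\succeq0,\ \sum_{l=1}^L\mathrm{Tr}(\Sigma_l)\le P_T$$ is at least $1$ if and only if the optimal value of $$\textbf{EFOP}:\ \max_{\{T,R,p\}}\ \min_{1\le m\le M_l,\ 1\le l\le L}\frac{\gamma_{l,m}}{\gamma^0_l}\quad\text{s.t. }\|p\|_1\le P_T$$ is at least $1$, where $M_l=\mathrm{Rank}(H_{l,l})$ and $\gamma^0_l=e^{\mathcal I^0_l/M_l}-1$.
   Context: A MIMO B-MAC network has $L$ data links. Link $l$ has transmitter $T_l$ with $L_{T_l}$ antennas and receiver $R_l$ with $L_{R_l}$ antennas; $H_{l,k}\in\mathbb C^{L_{R_l}\times L_{T_k}}$ is the channel matrix from $T_k$ to $R_l$. The input of link $k$ is circularly symmetric complex Gaussian with covariance $\Sigma_k\succeq0$, and the noise at each receiver is circularly symmetric complex Gaussian with identity covariance. A coupling matrix $\Phi\in\{0,1\}^{L\times L}$ with $\Phi_{l,l}=0$ specifies whether the signal of link $k$ still interferes with link $l$ after interference cancellation ($\Phi_{l,k}=1$) or is completely cancelled ($\Phi_{l,k}=0$); $\Phi$ is assumed valid, i.e. realizable by a scheme in which each signal is decoded by at most one receiver. For $\Sigma_{1:L}$ let $\Omega_l=I+\sum_{k=1}^L\Phi_{l,k}H_{l,k}\Sigma_kH_{l,k}^\dagger$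 and $\mathcal I_l(\Sigma_{1:L},\Phi)=\log\left|I+H_{l,l}\Sigma_lH_{l,l}^\dagger\Omega_l^{-1}\right|$. Streams: with $M_l$ streams for link $l$, a strategy $\{T,R,p\}$ consists of unit-norm transmit vectors $t_{l,m}\in\mathbb C^{L_{T_l}}$ (collected in $T$), powers $p_{l,m}\ge0$ (collected in $p$), and unit-norm receive vectors $r_{l,m}$ (collected in $R$); it corresponds to input covariances $\Sigma_l=\sum_m p_{l,m}t_{l,m}t_{l,m}^\dagger$. Streams of link $l$ are decoded in order $m=1,\dots,M_l$ with cancellation. Cross-talk coefficients: $\Psi^{k,n}_{l,m}=0$ if $k=l,m\ge n$; $=|r_{l,m}^\dagger H_{l,l}t_{l,n}|^2$ if $k=l,m<n$; $=\Phi_{l,k}|r_{l,m}^\dagger H_{l,k}t_{k,n}|^2$ otherwise. SINR: $\gamma_{l,m}=\dfrac{p_{l,m}|r_{l,m}^\dagger H_{l,l}t_{l,m}|^2}{1+\sum_{k}\sum_{n=1}^{M_k}p_{k,n}\Psi^{k,n}_{l,m}}$. *)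

theory Defs
  imports "HOL-Analysis.Analysis" "Jordan_Normal_Form.Schur_Decomposition"
    "Jordan_Normal_Form.DL_Rank" "Jordan_Normal_Form.Gauss_Jordan_Elimination"
begin

primrec mat_sum :: "nat \<Rightarrow> nat \<Rightarrow> (nat \<Rightarrow> complex mat) \<Rightarrow> nat \<Rightarrow> complex mat" where
  "mat_sum nr nc f 0 = 0\<^sub>m nr nc"
| "mat_sum nr nc f (Suc K) = mat_sum nr nc f K + f K"

definition mtrace :: "complex mat \<Rightarrow> complex" where
  "mtrace A = (\<Sum>i<dim_row A. A $$ (i, i))"

definition minv :: "complex mat \<Rightarrow> complex mat" where
  "minv A = the (mat_inverse A)"

definition mrank :: "complex mat \<Rightarrow> nat" where
  "mrank A = vec_space.rank (dim_row A) A"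

definition psd_mat :: "nat \<Rightarrow> complex mat \<Rightarrow> bool" where
  "psd_mat n A \<longleftrightarrow> A \<in> carrier_mat n n \<and> mat_adjoint A = A \<and>
     (\<forall>v \<in> carrier_vec n. 0 \<le> Re (conjugate v \<bullet> (A *\<^sub>v v)))"

definition unit_cvec :: "nat \<Rightarrow> complex vec \<Rightarrow> bool" where
  "unit_cvec n v \<longleftrightarrow> v \<in> carrier_vec n \<and> (\<Sum>i<n. (cmod (v $ i))\<^sup>2) = 1"

text \<open>Links are indexed 0..L-1; NT l, NR l antenna numbers; H l k is the channel from T_k to R_l
  (an NR l x NT k matrix); Phi l k = True means Phi_{l,k} = 1.\<close>

definition Omega :: "nat \<Rightarrow> (nat \<Rightarrow> nat) \<Rightarrow> (nat \<Rightarrow> nat \<Rightarrow> complex mat) \<Rightarrow> (nat \<Rightarrow> nat \<Rightarrow> bool)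
    \<Rightarrow> (nat \<Rightarrow> complex mat) \<Rightarrow> nat \<Rightarrow> complex mat" where
  "Omega L NR H Phi \<Sigma> l = 1\<^sub>m (NR l) +
     mat_sum (NR l) (NR l)
       (\<lambda>k. if Phi l k then H l k * \<Sigma> k * mat_adjoint (H l k) else 0\<^sub>m (NR l) (NR l)) L"

definition rate :: "nat \<Rightarrow> (nat \<Rightarrow> nat) \<Rightarrow> (nat \<Rightarrow> nat \<Rightarrow> complex mat) \<Rightarrow> (nat \<Rightarrow> nat \<Rightarrow> bool)
    \<Rightarrow> (nat \<Rightarrow> complex mat) \<Rightarrow> nat \<Rightarrow> real" where
  "rate L NR H Phi \<Sigma> l = ln (Re (det (1\<^sub>m (NR l) +
      H l l * \<Sigma> l * mat_adjoint (H l l) * minv (Omega L NR H Phi \<Sigma> l))))"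

definition gain :: "complex vec \<Rightarrow> complex mat \<Rightarrow> complex vec \<Rightarrow> real" where
  "gain r A t = (cmod (conjugate r \<bullet> (A *\<^sub>v t)))\<^sup>2"

text \<open>Cross-talk coefficient Psi^{k,n}_{l,m} (0-based stream indices, same order).\<close>
definition Psi :: "(nat \<Rightarrow> nat \<Rightarrow> complex mat) \<Rightarrow> (nat \<Rightarrow> nat \<Rightarrow> bool)
    \<Rightarrow> (nat \<Rightarrow> nat \<Rightarrow> complex vec) \<Rightarrow> (nat \<Rightarrow> nat \<Rightarrow> complex vec)
    \<Rightarrow> nat \<Rightarrow> nat \<Rightarrow> nat \<Rightarrow> nat \<Rightarrow> real" where
  "Psi H Phi T R l m k n =
     (if k = l then (if n \<le> m then 0 else gain (R l m) (H l l) (T l n))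
      else of_bool (Phi l k) * gain (R l m) (H l k) (T k n))"

definition SINR :: "nat \<Rightarrow> (nat \<Rightarrow> nat) \<Rightarrow> (nat \<Rightarrow> nat \<Rightarrow> complex mat) \<Rightarrow> (nat \<Rightarrow> nat \<Rightarrow> bool)
    \<Rightarrow> (nat \<Rightarrow> nat \<Rightarrow> complex vec) \<Rightarrow> (nat \<Rightarrow> nat \<Rightarrow> complex vec) \<Rightarrow> (nat \<Rightarrow> nat \<Rightarrow> real)
    \<Rightarrow> nat \<Rightarrow> nat \<Rightarrow> real" where
  "SINR L M H Phi T R p l m =
     p l m * gain (R l m) (H l l) (T l m) /
     (1 + (\<Sum>k<L. \<Sum>n<M k. p k n * Psi H Phi T R l m k n))"

definition FOP_feasible :: "nat \<Rightarrow> (nat \<Rightarrow> nat) \<Rightarrow> real \<Rightarrow> (nat \<Rightarrow> complex mat) \<Rightarrow> bool" where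
  "FOP_feasible L NT PT \<Sigma> \<longleftrightarrow> (\<forall>l<L. psd_mat (NT l) (\<Sigma> l)) \<and> (\<Sum>l<L. Re (mtrace (\<Sigma> l))) \<le> PT"

definition FOP_obj :: "nat \<Rightarrow> (nat \<Rightarrow> nat) \<Rightarrow> (nat \<Rightarrow> nat \<Rightarrow> complex mat) \<Rightarrow> (nat \<Rightarrow> nat \<Rightarrow> bool)
    \<Rightarrow> (nat \<Rightarrow> real) \<Rightarrow> (nat \<Rightarrow> complex mat) \<Rightarrow> real" where
  "FOP_obj L NR H Phi I0 \<Sigma> = (MIN l\<in>{..<L}. rate L NR H Phi \<Sigma> l / I0 l)"

definition FOP_value :: "nat \<Rightarrow> (nat \<Rightarrow> nat) \<Rightarrow> (nat \<Rightarrow> nat) \<Rightarrow> (nat \<Rightarrow> nat \<Rightarrow> complex mat)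
    \<Rightarrow> (nat \<Rightarrow> nat \<Rightarrow> bool) \<Rightarrow> (nat \<Rightarrow> real) \<Rightarrow> real \<Rightarrow> real" where
  "FOP_value L NT NR H Phi I0 PT =
     Sup (FOP_obj L NR H Phi I0 ` {\<Sigma>. FOP_feasible L NT PT \<Sigma>})"

definition EFOP_feasible :: "nat \<Rightarrow> (nat \<Rightarrow> nat) \<Rightarrow> (nat \<Rightarrow> nat) \<Rightarrow> (nat \<Rightarrow> nat) \<Rightarrow> real
    \<Rightarrow> (nat \<Rightarrow> nat \<Rightarrow> complex vec) \<Rightarrow> (nat \<Rightarrow> nat \<Rightarrow> complex vec) \<Rightarrow> (nat \<Rightarrow> nat \<Rightarrow> real) \<Rightarrow> bool" where
  "EFOP_feasible L NT NR M PT T R p \<longleftrightarrow>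
     (\<forall>l<L. \<forall>m<M l. unit_cvec (NT l) (T l m) \<and> unit_cvec (NR l) (R l m) \<and> 0 \<le> p l m) \<and>
     (\<Sum>l<L. \<Sum>m<M l. \<bar>p l m\<bar>) \<le> PT"

definition EFOP_obj :: "nat \<Rightarrow> (nat \<Rightarrow> nat) \<Rightarrow> (nat \<Rightarrow> nat \<Rightarrow> complex mat) \<Rightarrow> (nat \<Rightarrow> nat \<Rightarrow> bool)
    \<Rightarrow> (nat \<Rightarrow> real) \<Rightarrow> (nat \<Rightarrow> nat \<Rightarrow> complex vec) \<Rightarrow> (nat \<Rightarrow> nat \<Rightarrow> complex vec)
    \<Rightarrow> (nat \<Rightarrow> nat \<Rightarrow> real) \<Rightarrow> real" where
  "EFOP_obj L M H Phi g0 T R p =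
     Min {SINR L M H Phi T R p l m / g0 l | l m. l < L \<and> m < M l}"

definition EFOP_value :: "nat \<Rightarrow> (nat \<Rightarrow> nat) \<Rightarrow> (nat \<Rightarrow> nat) \<Rightarrow> (nat \<Rightarrow> nat) \<Rightarrow> (nat \<Rightarrow> nat \<Rightarrow> complex mat)
    \<Rightarrow> (nat \<Rightarrow> nat \<Rightarrow> bool) \<Rightarrow> (nat \<Rightarrow> real) \<Rightarrow> real \<Rightarrow> real" where
  "EFOP_value L NT NR M H Phi g0 PT =
     Sup ((\<lambda>(T, R, p). EFOP_obj L M H Phi g0 T R p) `
          {(T, R, p). EFOP_feasible L NT NR M PT T R p})"

end

theory Submission
  imports Defs
begin

text \<open>
  Write a covariance as \<open>\<Sigma> = \<Sum>m s\<^sub>m s\<^sub>m\<^sup>*\<close>, put \<open>h\<^sub>m = H s\<^sub>m\<close> and let \<open>K\<close> be the noise-plus-interference covariance. The rate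
  is \<open>ln (det (K + \<Sum>m h\<^sub>m h\<^sub>m\<^sup>*) / det K)\<close>, and adding the rank-one terms one at a time, last stream first,
  multiplies the determinant by \<open>1 + h\<^sub>m\<^sup>* K\<^sub>m\<^sup>-\<^sup>1 h\<^sub>m\<close>, where \<open>K\<^sub>m\<close> is what stream \<open>m\<close> sees. By Cauchy-Schwarz every
  receiver has SINR at most \<open>h\<^sub>m\<^sup>* K\<^sub>m\<^sup>-\<^sup>1 h\<^sub>m\<close>, so SINRs \<open>\<ge> \<gamma>\<close> force rate \<open>\<ge> M ln (1 + \<gamma>)\<close>.

  Conversely, subtracting rank-one terms of \<open>\<Sigma>\<close> along a basis of the row space of \<open>H\<close> leaves \<open>rank H\<close> vectors carrying the same
  received signal with less power and less interference. Unitary recombinations of these vectors do not change the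
  covariance, and they allow all SINRs to be made equal: if \<open>det (K + \<Sum>m h\<^sub>m h\<^sub>m\<^sup>*) = d\<^sup>N det K\<close>, the
  \<open>N \<times> N\<close> matrix \<open>G = 1 + (h\<^sub>i\<^sup>* K\<^sup>-\<^sup>1 h\<^sub>j)\<close> has determinant \<open>d\<^sup>N\<close>, hence an eigenvalue at most and one at least \<open>d\<close>,
  hence a unit vector \<open>c\<close> with \<open>c\<^sup>* G c = d\<close>; the last stream is the combination with coefficients \<open>c\<close>, and induction
  handles the others with \<open>K\<close> enlarged by that stream. Neither supremum need be shown to be attained: approximate
  optima of either problem give approximate optima of the other.
\<close>

unbundle no vec_syntax and no inner_syntax

subsection \<open>Hermitian forms\<close>

text \<open>Conjugate-linear in the first argument, so that \<open>cip r (A *\<^sub>v t)\<close> is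
  the amplitude whose squared modulus is \<open>gain r A t\<close>.\<close>

definition cip :: "complex vec \<Rightarrow> complex vec \<Rightarrow> complex" where
  "cip u v = conjugate u \<bullet> v"

text \<open>The real part loses nothing for the Hermitian matrices of interest, whose form is
  already real (\<open>herm_form\<close>).\<close>

definition qform :: "complex mat \<Rightarrow> complex vec \<Rightarrow> real" where
  "qform A v = Re (cip v (A *\<^sub>v v))"

definition pd_mat :: "nat \<Rightarrow> complex mat \<Rightarrow> bool" where
  "pd_mat n A \<longleftrightarrow> A \<in> carrier_mat n n \<and> mat_adjoint A = A \<and>
     (\<forall>v \<in> carrier_vec n. v \<noteq> 0\<^sub>v n \<longrightarrow> 0 < qform A v)"

lemma adjoint_carrier [simp]: "A \<in> carrier_mat nr nc \<Longrightarrow> mat_adjoint A \<in> carrier_mat nc nr"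
  unfolding mat_adjoint_def by auto

lemma adjoint_dim [simp]: "dim_row (mat_adjoint A) = dim_col A" "dim_col (mat_adjoint A) = dim_row A"
  unfolding mat_adjoint_def by auto

lemma adjoint_index [simp]:
  "i < dim_col A \<Longrightarrow> j < dim_row A \<Longrightarrow> mat_adjoint A $$ (i, j) = cnj (A $$ (j, i))"
  unfolding mat_adjoint_def mat_of_rows_def by simp

lemma adjoint_adjoint [simp]: "mat_adjoint (mat_adjoint A) = (A :: complex mat)"
  by (rule eq_matI) auto

lemma cip_sum: "u \<in> carrier_vec n \<Longrightarrow> v \<in> carrier_vec n \<Longrightarrow> cip u v = (\<Sum>i<n. cnj (u $ i) * v $ i)"
  unfolding cip_def scalar_prod_def by (auto simp: atLeast0LessThan intro!: sum.cong)

lemma mult_mat_vec_index_sum: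
  "A \<in> carrier_mat nr nc \<Longrightarrow> v \<in> carrier_vec nc \<Longrightarrow> i < nr \<Longrightarrow>
   (A *\<^sub>v v) $ i = (\<Sum>j<nc. A $$ (i, j) * v $ j)"
  by (auto simp: scalar_prod_def atLeast0LessThan)

lemma mult_mat_index_sum:
  "A \<in> carrier_mat nr n \<Longrightarrow> B \<in> carrier_mat n nc \<Longrightarrow> i < nr \<Longrightarrow> j < nc \<Longrightarrow>
   (A * B) $$ (i, j) = (\<Sum>k<n. A $$ (i, k) * B $$ (k, j))"
  by (auto simp: scalar_prod_def atLeast0LessThan)

lemma cip_swap: "u \<in> carrier_vec n \<Longrightarrow> v \<in> carrier_vec n \<Longrightarrow> cip v u = cnj (cip u v)"
  by (simp add: cip_sum mult.commute)

lemma cip_add_right: "u \<in> carrier_vec n \<Longrightarrow> v \<in> carrier_vec n \<Longrightarrow> w \<in> carrier_vec n \<Longrightarrow>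
    cip u (v + w) = cip u v + cip u w"
  unfolding cip_def by (rule scalar_prod_add_distrib) auto

lemma cip_add_left: "u \<in> carrier_vec n \<Longrightarrow> v \<in> carrier_vec n \<Longrightarrow> w \<in> carrier_vec n \<Longrightarrow>
    cip (u + v) w = cip u w + cip v w"
  by (simp add: cip_sum[where n = n] algebra_simps sum.distrib)

lemma cip_smult_right: "u \<in> carrier_vec n \<Longrightarrow> v \<in> carrier_vec n \<Longrightarrow> cip u (a \<cdot>\<^sub>v v) = a * cip u v"
  by (simp add: cip_sum sum_distrib_left mult.left_commute)

lemma cip_smult_left: "u \<in> carrier_vec n \<Longrightarrow> v \<in> carrier_vec n \<Longrightarrow> cip (a \<cdot>\<^sub>v u) v = cnj a * cip u v"
  by (simp add: cip_sum sum_distrib_left mult.assoc)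

lemma cip_adjoint:
  assumes "A \<in> carrier_mat nr nc" "u \<in> carrier_vec nr" "v \<in> carrier_vec nc"
  shows "cip u (A *\<^sub>v v) = cip (mat_adjoint A *\<^sub>v u) v"
proof -
  have "cip u (A *\<^sub>v v) = (\<Sum>i<nr. \<Sum>j<nc. cnj (u $ i) * (A $$ (i, j) * v $ j))"
    using assms by (simp add: cip_sum[where n = nr] mult_mat_vec_index_sum[OF assms(1,3)] sum_distrib_left
      del: index_mult_mat_vec)
  also have "\<dots> = (\<Sum>j<nc. \<Sum>i<nr. cnj (u $ i) * (A $$ (i, j) * v $ j))"
    by (rule sum.swap)
  also have "\<dots> = cip (mat_adjoint A *\<^sub>v u) v"
    using assms by (simp add: cip_sum[OF mult_mat_vec_carrier[OF adjoint_carrier[OF assms(1)] assms(2)] assms(3)]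
      mult_mat_vec_index_sum[OF adjoint_carrier[OF assms(1)] assms(2)] sum_distrib_left sum_distrib_right mult_ac del: index_mult_mat_vec)
  finally show ?thesis .
qed

lemma cip_self: "v \<in> carrier_vec n \<Longrightarrow> cip v v = of_real (\<Sum>i<n. (cmod (v $ i))\<^sup>2)"
  by (simp add: cip_sum complex_norm_square mult.commute del: of_real_power)

lemma cip_self_pos: "v \<in> carrier_vec n \<Longrightarrow> v \<noteq> 0\<^sub>v n \<Longrightarrow> 0 < Re (cip v v)"
proof -
  assume v: "v \<in> carrier_vec n" "v \<noteq> 0\<^sub>v n"
  then obtain i where i: "i < n" "v $ i \<noteq> 0" by (metis carrier_vecD eq_vecI index_zero_vec)
  have "0 < (\<Sum>i<n. (cmod (v $ i))\<^sup>2)"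
    by (rule sum_pos2[of _ i]) (use i in auto)
  then show ?thesis by (simp add: cip_self[OF v(1)])
qed

lemma unit_cvec_iff: "unit_cvec n v \<longleftrightarrow> v \<in> carrier_vec n \<and> cip v v = 1"
  unfolding unit_cvec_def using cip_self[of v n] by (metis of_real_1 of_real_eq_iff)

lemma normalize_unit:
  assumes "v \<in> carrier_vec n" "v \<noteq> 0\<^sub>v n"
  shows "unit_cvec n (complex_of_real (1 / sqrt (Re (cip v v))) \<cdot>\<^sub>v v)"
proof -
  have p: "0 < Re (cip v v)" by (rule cip_self_pos[OF assms])
  have r: "cip v v = of_real (Re (cip v v))" using cip_self[OF assms(1)] by simp
  have q: "complex_of_real (sqrt (Re (cip v v))) * complex_of_real (sqrt (Re (cip v v))) = cip v v"
    by (subst r) (use p in \<open>simp flip: of_real_mult\<close>)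
  have nz: "cip v v \<noteq> 0" using p by auto
  show ?thesis unfolding unit_cvec_iff using assms p
    by (simp add: cip_smult_left[where n = n] cip_smult_right[where n = n] q nz)
qed

lemma herm_form:
  assumes "A \<in> carrier_mat n n" "mat_adjoint A = A" "v \<in> carrier_vec n"
  shows "cip v (A *\<^sub>v v) = of_real (qform A v)"
proof -
  have "cip v (A *\<^sub>v v) = cip (A *\<^sub>v v) v" using cip_adjoint[OF assms(1,3,3)] assms(2) by simp
  also have "\<dots> = cnj (cip v (A *\<^sub>v v))" using assms by (intro cip_swap) auto
  finally show ?thesis unfolding qform_def by (simp add: complex_eq_iff)
qed

lemma herm_swap:
  assumes "A \<in> carrier_mat n n" "mat_adjoint A = A" "u \<in> carrier_vec n" "v \<in> carrier_vec n"
  shows "cip v (A *\<^sub>v u) = cnj (cip u (A *\<^sub>v v))"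
  using cip_adjoint[OF assms(1,4,3)] assms cip_swap[of u n "A *\<^sub>v v"] by simp

lemma mult_mat_vec_lin:
  assumes "A \<in> carrier_mat nr nc" "u \<in> carrier_vec nc" "v \<in> carrier_vec nc"
  shows "A *\<^sub>v (a \<cdot>\<^sub>v u + b \<cdot>\<^sub>v v) = a \<cdot>\<^sub>v (A *\<^sub>v u) + b \<cdot>\<^sub>v ((A :: complex mat) *\<^sub>v v)"
  using assms by (simp add: mult_add_distrib_mat_vec[of A nr nc] mult_mat_vec[of A nr nc])

text \<open>Hermitian symmetry makes the two cross terms conjugate, so they add up to twice a real
  part. This expansion drives both Cauchy-Schwarz and the search for a unit vector with a prescribed
  form value.\<close>

lemma qform_comb:
  assumes A: "A \<in> carrier_mat n n" "mat_adjoint A = A" and u: "u \<in> carrier_vec n" and v: "v \<in> carrier_vec n"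
  shows "qform A (a \<cdot>\<^sub>v u + b \<cdot>\<^sub>v v) =
    (cmod a)\<^sup>2 * qform A u + (cmod b)\<^sup>2 * qform A v + 2 * Re (cnj a * b * cip u (A *\<^sub>v v))"
proof -
  let ?c = "cip u (A *\<^sub>v v)"
  have [simp]: "A *\<^sub>v u \<in> carrier_vec n" "A *\<^sub>v v \<in> carrier_vec n" using assms by auto
  have "cip (a \<cdot>\<^sub>v u + b \<cdot>\<^sub>v v) (A *\<^sub>v (a \<cdot>\<^sub>v u + b \<cdot>\<^sub>v v)) =
     cnj a * a * cip u (A *\<^sub>v u) + cnj b * b * cip v (A *\<^sub>v v) + cnj a * b * ?c + cnj b * a * cip v (A *\<^sub>v u)"
    unfolding mult_mat_vec_lin[OF A(1) u v]
    using u v by (simp add: cip_add_left[where n = n] cip_add_right[where n = n] cip_smult_left[where n = n]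
        cip_smult_right[where n = n] algebra_simps)
  also have "\<dots> = of_real ((cmod a)\<^sup>2 * qform A u) + of_real ((cmod b)\<^sup>2 * qform A v)
      + (cnj a * b * ?c + cnj (cnj a * b * ?c))"
    unfolding herm_form[OF A u] herm_form[OF A v] herm_swap[OF A u v]
    by (simp add: complex_norm_square mult_ac del: of_real_power)
  finally show ?thesis unfolding qform_def[of A "_ + _"] by (simp add: algebra_simps)
qed

lemma psd_matD:
  assumes "psd_mat n A"
  shows "A \<in> carrier_mat n n" "mat_adjoint A = A" "v \<in> carrier_vec n \<Longrightarrow> 0 \<le> qform A v"
  using assms unfolding psd_mat_def qform_def cip_def by auto

lemma psd_matI:
  assumes "A \<in> carrier_mat n n" "mat_adjoint A = A" "\<And>v. v \<in> carrier_vec n \<Longrightarrow> 0 \<le> qform A v"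
  shows "psd_mat n A"
  using assms unfolding psd_mat_def qform_def cip_def by auto

lemma pd_matD:
  assumes "pd_mat n A"
  shows "A \<in> carrier_mat n n" "mat_adjoint A = A" "v \<in> carrier_vec n \<Longrightarrow> v \<noteq> 0\<^sub>v n \<Longrightarrow> 0 < qform A v"
  using assms unfolding pd_mat_def by auto

lemma pd_imp_psd: "pd_mat n A \<Longrightarrow> psd_mat n A"
  unfolding pd_mat_def
  by (rule psd_matI; (simp; fail)?) (metis carrier_vecD cip_def conjugate_zero_vec index_mult_mat_vec
    less_eq_real_def order_refl qform_def scalar_prod_left_zero zero_complex.simps(1) carrier_matD(1)
    mult_mat_vec_carrier)

text \<open>The form is nonnegative on \<open>s u - t cnj c v\<close> for all real \<open>s\<close>
  and \<open>t\<close>; the factor \<open>cnj c\<close> turns the phase so that the cross term is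
  real. Suitable \<open>s\<close> and \<open>t\<close> give the bound.\<close>

lemma psd_cauchy_schwarz:
  assumes A: "psd_mat n A" and u: "u \<in> carrier_vec n" and v: "v \<in> carrier_vec n"
  shows "(cmod (cip u (A *\<^sub>v v)))\<^sup>2 \<le> qform A u * qform A v"
proof -
  define c where "c = cip u (A *\<^sub>v v)"
  have c2: "cnj c * c = of_real ((cmod c)\<^sup>2)" by (simp add: complex_norm_square mult.commute del: of_real_power)
  have key: "0 \<le> s\<^sup>2 * qform A u + t\<^sup>2 * (cmod c)\<^sup>2 * qform A v - 2 * s * t * (cmod c)\<^sup>2" for s t :: real
  proof -
    have "0 \<le> qform A (complex_of_real s \<cdot>\<^sub>v u + (- of_real t * cnj c) \<cdot>\<^sub>v v)"
      by (rule psd_matD(3)[OF A]) (use u v in auto)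
    also have "\<dots> = s\<^sup>2 * qform A u + t\<^sup>2 * (cmod c)\<^sup>2 * qform A v
        + 2 * Re (- of_real (s * t) * (cnj c * c))"
      unfolding qform_comb[OF psd_matD(1,2)[OF A] u v] c_def[symmetric]
      by (simp add: norm_mult power_mult_distrib mult_ac)
    also have "\<dots> = s\<^sup>2 * qform A u + t\<^sup>2 * (cmod c)\<^sup>2 * qform A v - 2 * s * t * (cmod c)\<^sup>2"
      unfolding c2 by simp
    finally show ?thesis .
  qed
  have qu: "0 \<le> qform A u" and qv: "0 \<le> qform A v" using psd_matD(3)[OF A] u v by auto
  show ?thesis unfolding c_def[symmetric]
  proof (cases "qform A v = 0")
    case False
    have "0 \<le> qform A v * (qform A u * qform A v - (cmod c)\<^sup>2)"
      using key[of "qform A v" 1] by (simp add: power2_eq_square algebra_simps)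
    then show "(cmod c)\<^sup>2 \<le> qform A u * qform A v"
      using False qv by (simp add: zero_le_mult_iff)
  next
    case True
    show "(cmod c)\<^sup>2 \<le> qform A u * qform A v"
    proof -
      have "(cmod c)\<^sup>2 \<le> 0"
      proof (rule ccontr)
        assume "\<not> (cmod c)\<^sup>2 \<le> 0"
        then have p: "(cmod c)\<^sup>2 > 0" by simp
        \<comment> \<open>A large multiple of \<open>v\<close> would make the form negative: with
          this \<open>t\<close> the inequality reads \<open>0 \<le> - qform A u - 2\<close>.\<close>
        show False using key[of 1 "(qform A u + 1) / (cmod c)\<^sup>2"] True p qu by simp
      qed
      then show ?thesis using True by simp
    qed
  qed
qed

text \<open>Cauchy-Schwarz for the pair \<open>A v\<close>, \<open>v\<close> bounds the squared norm
  of \<open>A v\<close> by zero.\<close>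

lemma psd_kernel:
  assumes A: "psd_mat n A" and v: "v \<in> carrier_vec n" and z: "qform A v = 0"
  shows "A *\<^sub>v v = 0\<^sub>v n"
proof (rule ccontr)
  assume "A *\<^sub>v v \<noteq> 0\<^sub>v n"
  then have "0 < Re (cip (A *\<^sub>v v) (A *\<^sub>v v))"
    using psd_matD(1)[OF A] v by (intro cip_self_pos) auto
  moreover have "(cmod (cip (A *\<^sub>v v) (A *\<^sub>v v)))\<^sup>2 \<le> 0"
    using psd_cauchy_schwarz[OF A _ v, of "A *\<^sub>v v"] z psd_matD(1)[OF A] v by simp
  ultimately show False by simp
qed

subsection \<open>Determinants of low-rank updates\<close>

lemma adjoint_mult:
  assumes "A \<in> carrier_mat nr n" "B \<in> carrier_mat n nc"
  shows "mat_adjoint (A * B) = mat_adjoint B * mat_adjoint (A :: complex mat)"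
proof (rule eq_matI)
  show "mat_adjoint (A * B) $$ (i, j) = (mat_adjoint B * mat_adjoint A) $$ (i, j)"
    if "i < dim_row (mat_adjoint B * mat_adjoint A)" "j < dim_col (mat_adjoint B * mat_adjoint A)" for i j
    using assms that
    by (subst mult_mat_index_sum[of _ nc n _ nr]) (auto simp: scalar_prod_def atLeast0LessThan mult.commute intro!: sum.cong)
qed (use assms in auto)

lemma adjoint_add:
  assumes "A \<in> carrier_mat nr nc" "B \<in> carrier_mat nr nc"
  shows "mat_adjoint (A + B) = mat_adjoint A + mat_adjoint (B :: complex mat)"
  by (rule eq_matI) (use assms in auto)

lemma qform_add:
  assumes "A \<in> carrier_mat n n" "B \<in> carrier_mat n n" "v \<in> carrier_vec n"
  shows "qform (A + B) v = qform A v + qform B v"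
  unfolding qform_def using assms
  by (simp add: add_mult_distrib_mat_vec[of A n n] cip_add_right[where n = n])

lemma qform_congruence:
  assumes "H \<in> carrier_mat nr nt" "A \<in> carrier_mat nt nt" "v \<in> carrier_vec nr"
  shows "qform (H * A * mat_adjoint H) v = qform A (mat_adjoint H *\<^sub>v v)"
proof -
  have c: "mat_adjoint H \<in> carrier_mat nt nr" "mat_adjoint H *\<^sub>v v \<in> carrier_vec nt"
    using assms by (auto intro!: mult_mat_vec_carrier)
  have e: "H * A * mat_adjoint H *\<^sub>v v = H *\<^sub>v (A *\<^sub>v (mat_adjoint H *\<^sub>v v))"
    using assms c by (simp add: assoc_mult_mat_vec[of _ nr nt _ nr] assoc_mult_mat_vec[of _ nr nt _ nt])
  show ?thesis unfolding qform_def e using assms c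
    by (subst cip_adjoint[of H nr nt]) auto
qed

section \<open>Covariances as sums of rank-one terms\<close>

definition colmat :: "nat \<Rightarrow> nat \<Rightarrow> (nat \<Rightarrow> complex vec) \<Rightarrow> complex mat" where
  "colmat n N s = mat n N (\<lambda>(i, k). s k $ i)"

text \<open>This is the sum of \<open>s\<^sub>k s\<^sub>k\<^sup>*\<close>, encoded as
  \<open>S S\<^sup>*\<close> so that congruences and determinant identities become statements about
  matrix products.\<close>

definition cov :: "nat \<Rightarrow> nat \<Rightarrow> (nat \<Rightarrow> complex vec) \<Rightarrow> complex mat" where
  "cov n N s = colmat n N s * mat_adjoint (colmat n N s)"

definition outer :: "nat \<Rightarrow> complex vec \<Rightarrow> complex mat" where
  "outer n v = cov n 1 (\<lambda>_. v)"

lemma colmat_carrier [simp]: "colmat n N s \<in> carrier_mat n N"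
  unfolding colmat_def by simp

lemma colmat_index [simp]: "i < n \<Longrightarrow> k < N \<Longrightarrow> colmat n N s $$ (i, k) = s k $ i"
  unfolding colmat_def by simp

lemma colmat_dim [simp]: "dim_row (colmat n N s) = n" "dim_col (colmat n N s) = N"
  unfolding colmat_def by simp_all

lemma cov_carrier [simp]: "cov n N s \<in> carrier_mat n n"
  unfolding cov_def by (rule mult_carrier_mat[of _ _ N]) auto

lemma cov_dim [simp]: "dim_row (cov n N s) = n" "dim_col (cov n N s) = n"
  using cov_carrier by blast+

lemma cov_index: "i < n \<Longrightarrow> j < n \<Longrightarrow> cov n N s $$ (i, j) = (\<Sum>k<N. s k $ i * cnj (s k $ j))"
  unfolding cov_def by (subst mult_mat_index_sum[of _ n N _ n]) (auto intro!: sum.cong)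

lemma cov_eqI:
  "(\<And>i j. i < n \<Longrightarrow> j < n \<Longrightarrow>
     (\<Sum>k<N. s k $ i * cnj (s k $ j)) = (\<Sum>k<M. t k $ i * cnj (t k $ j))) \<Longrightarrow> cov n N s = cov n M t"
  by (rule eq_matI) (auto simp: cov_index)

lemma cov_cong: "(\<And>k. k < N \<Longrightarrow> s k = t k) \<Longrightarrow> cov n N s = cov n N t"
  by (rule cov_eqI) auto

lemma cov_0 [simp]: "cov n 0 s = 0\<^sub>m n n"
  by (rule eq_matI) (auto simp: cov_index)

lemma outer_carrier [simp]: "outer n v \<in> carrier_mat n n"
  unfolding outer_def by simp

lemma outer_dim [simp]: "dim_row (outer n v) = n" "dim_col (outer n v) = n"
  unfolding outer_def by simp_all

lemma outer_index: "i < n \<Longrightarrow> j < n \<Longrightarrow> outer n v $$ (i, j) = v $ i * cnj (v $ j)"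
  unfolding outer_def by (simp add: cov_index)

lemma cov_Suc: "cov n (Suc N) s = cov n N s + outer n (s N)"
  by (rule eq_matI) (auto simp: cov_index outer_index)

lemma cov_hermitian [simp]: "mat_adjoint (cov n N s) = cov n N s"
  by (rule eq_matI) (auto simp: cov_index mult.commute)

lemma mult_colmat:
  assumes H: "H \<in> carrier_mat nr nt" and s: "\<And>k. k < N \<Longrightarrow> s k \<in> carrier_vec nt"
  shows "H * colmat nt N s = colmat nr N (\<lambda>k. H *\<^sub>v s k)"
proof (rule eq_matI)
  show "(H * colmat nt N s) $$ (i, k) = colmat nr N (\<lambda>k. H *\<^sub>v s k) $$ (i, k)"
    if "i < dim_row (colmat nr N (\<lambda>k. H *\<^sub>v s k))" "k < dim_col (colmat nr N (\<lambda>k. H *\<^sub>v s k))" for i k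
    using that H s[of k]
    by (simp add: mult_mat_index_sum[OF H colmat_carrier] mult_mat_vec_index_sum[OF H s]
        del: index_mult_mat index_mult_mat_vec)
qed (use H in auto)

lemma adjoint_colmat_mult:
  assumes "\<And>k. k < N \<Longrightarrow> h k \<in> carrier_vec n" "\<And>k. k < N \<Longrightarrow> x k \<in> carrier_vec n"
  shows "mat_adjoint (colmat n N h) * colmat n N x = mat N N (\<lambda>(i, j). cip (h i) (x j))"
proof (rule eq_matI)
  fix i j assume "i < dim_row (mat N N (\<lambda>(i, j). cip (h i) (x j)))" "j < dim_col (mat N N (\<lambda>(i, j). cip (h i) (x j)))"
  then show "(mat_adjoint (colmat n N h) * colmat n N x) $$ (i, j) = mat N N (\<lambda>(i, j). cip (h i) (x j)) $$ (i, j)"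
    using assms(1)[of i] assms(2)[of j]
    by (subst mult_mat_index_sum[of _ N n _ N]) (auto simp: cip_sum[of _ n])
qed auto

text \<open>\<open>H S\<close> has the columns \<open>H s\<^sub>k\<close>: a channel acts on every
  stream vector separately, and the received covariance is again a \<open>cov\<close>.\<close>

lemma congruence_cov:
  assumes H: "H \<in> carrier_mat nr nt" and s: "\<And>k. k < N \<Longrightarrow> s k \<in> carrier_vec nt"
  shows "H * cov nt N s * mat_adjoint H = cov nr N (\<lambda>k. H *\<^sub>v s k)"
proof -
  let ?S = "colmat nt N s"
  have e: "H * ?S = colmat nr N (\<lambda>k. H *\<^sub>v s k)" by (rule mult_colmat[OF H s])
  have "H * cov nt N s * mat_adjoint H = H * ?S * (mat_adjoint ?S * mat_adjoint H)"
    unfolding cov_def using H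
    by (simp add: assoc_mult_mat[of H nr nt ?S N "mat_adjoint ?S" nt, symmetric]
        assoc_mult_mat[of "H * ?S" nr N "mat_adjoint ?S" nt "mat_adjoint H" nr])
  also have "mat_adjoint ?S * mat_adjoint H = mat_adjoint (H * ?S)"
    using adjoint_mult[OF H colmat_carrier] by simp
  finally show ?thesis unfolding e cov_def .
qed

lemma qform_cov:
  assumes s: "\<And>k. k < N \<Longrightarrow> s k \<in> carrier_vec n" and w: "w \<in> carrier_vec n"
  shows "qform (cov n N s) w = (\<Sum>k<N. (cmod (cip w (s k)))\<^sup>2)"
proof -
  let ?S = "colmat n N s" and ?z = "mat_adjoint (colmat n N s) *\<^sub>v w"
  have z: "?z \<in> carrier_vec N" using w by (auto intro!: mult_mat_vec_carrier)
  have zk: "?z $ k = cip (s k) w" if "k < N" for k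
    using that w s[OF that] by (subst mult_mat_vec_index_sum[of _ N n]) (auto simp: cip_sum[of _ n])
  have "cov n N s *\<^sub>v w = ?S *\<^sub>v ?z"
    unfolding cov_def using w by (intro assoc_mult_mat_vec[of _ n N _ n]) auto
  then have "qform (cov n N s) w = Re (cip ?z ?z)"
    unfolding qform_def using z w by (simp add: cip_adjoint[of ?S n N])
  also have "\<dots> = (\<Sum>k<N. (cmod (?z $ k))\<^sup>2)"
    using cip_self[OF z] by simp
  also have "\<dots> = (\<Sum>k<N. (cmod (cip w (s k)))\<^sup>2)"
    using s w by (intro sum.cong) (auto simp: zk cip_swap[of w n] simp del: index_mult_mat_vec)
  finally show ?thesis .
qed

lemma qform_outer:
  "s \<in> carrier_vec n \<Longrightarrow> w \<in> carrier_vec n \<Longrightarrow> qform (outer n s) w = (cmod (cip w s))\<^sup>2"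
  unfolding outer_def by (simp add: qform_cov)

lemma outer_mult_vec:
  assumes "s \<in> carrier_vec n" "u \<in> carrier_vec n"
  shows "outer n s *\<^sub>v u = cip s u \<cdot>\<^sub>v s"
proof (rule eq_vecI)
  fix i assume "i < dim_vec (cip s u \<cdot>\<^sub>v s)"
  then have i: "i < n" using assms by simp
  have "(outer n s *\<^sub>v u) $ i = (\<Sum>j<n. s $ i * (cnj (s $ j) * u $ j))"
    using i by (simp add: mult_mat_vec_index_sum[OF outer_carrier assms(2)] outer_index mult.assoc del: index_mult_mat_vec)
  then show "(outer n s *\<^sub>v u) $ i = (cip s u \<cdot>\<^sub>v s) $ i"
    using i assms by (simp add: cip_sum[of _ n] mult.commute flip: sum_distrib_left)
qed (use assms in auto)

text \<open>One block matrix has two factorizations into block triangular factors, sharing a factor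
  \<open>?L\<close> of determinant 1; comparing determinants gives the identity.\<close>

lemma det_sylvester:
  assumes X: "X \<in> carrier_mat n m" and Y: "(Y :: complex mat) \<in> carrier_mat m n"
  shows "det (1\<^sub>m n + X * Y) = det (1\<^sub>m m + Y * X)"
proof -
  let ?B = "four_block_mat (1\<^sub>m n) (- X) Y (1\<^sub>m m)"
  let ?L = "four_block_mat (1\<^sub>m n) (0\<^sub>m n m) Y (1\<^sub>m m)"
  have XY: "X * Y \<in> carrier_mat n n" and YX: "Y * X \<in> carrier_mat m m" using X Y by auto
  have B1: "?B = ?L * four_block_mat (1\<^sub>m n) (- X) (0\<^sub>m m n) (1\<^sub>m m + Y * X)"
    using X Y by (subst mult_four_block_mat[of _ n n _ m _ m _ _ n _ m]) auto
  have B2: "?B = four_block_mat (1\<^sub>m n + X * Y) (- X) (0\<^sub>m m n) (1\<^sub>m m) * ?L"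
    using X Y by (subst mult_four_block_mat[of _ n n _ m _ m _ _ n _ m]) auto
  have L: "?L \<in> carrier_mat (n + m) (n + m)" by auto
  have dL: "det ?L = 1"
    using Y by (subst det_four_block_mat_upper_right_zero[of _ n _ m]) auto
  have "det ?B = det (1\<^sub>m m + Y * X)"
    unfolding B1 using X Y L
    by (subst det_mult[OF L]) (auto simp: dL det_four_block_mat_lower_left_zero[of _ n _ m])
  moreover have "det ?B = det (1\<^sub>m n + X * Y)"
    unfolding B2 using X Y L
    by (subst det_mult[OF _ L]) (auto simp: dL det_four_block_mat_lower_left_zero[of _ n _ m])
  ultimately show ?thesis by simp
qed

lemma det_add_cov:
  assumes K: "K \<in> carrier_mat n n" and x: "\<And>k. k < N \<Longrightarrow> x k \<in> carrier_vec n"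
    and h: "\<And>k. k < N \<Longrightarrow> K *\<^sub>v x k = h k"
  shows "det (K + cov n N h) = det K * det (1\<^sub>m N + mat_adjoint (colmat n N h) * colmat n N x)"
proof -
  let ?S = "colmat n N h" and ?X = "colmat n N x"
  have KX: "K * ?X = ?S"
    by (subst mult_colmat[OF K]) (auto simp: x h intro!: eq_matI simp del: index_mult_mat_vec)
  have Sa: "mat_adjoint ?S \<in> carrier_mat N n" by simp
  have "K + cov n N h = K * 1\<^sub>m n + K * (?X * mat_adjoint ?S)"
    unfolding cov_def using K KX[symmetric] assoc_mult_mat[OF K colmat_carrier Sa] by simp
  also have "\<dots> = K * (1\<^sub>m n + ?X * mat_adjoint ?S)"
    using K Sa by (subst mult_add_distrib_mat[of _ n n]) auto
  finally have "det (K + cov n N h) = det K * det (1\<^sub>m n + ?X * mat_adjoint ?S)"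
    using det_mult[OF K, of "1\<^sub>m n + ?X * mat_adjoint ?S"] mult_carrier_mat[OF colmat_carrier Sa] by simp
  then show ?thesis
    unfolding det_sylvester[OF colmat_carrier Sa] .
qed

lemma det_add_outer:
  assumes "K \<in> carrier_mat n n" "x \<in> carrier_vec n" "K *\<^sub>v x = h"
  shows "det (K + outer n h) = det K * (1 + cip h x)"
proof -
  have "h \<in> carrier_vec n" using assms(1,2) assms(3)[symmetric] by simp
  then show ?thesis
    using assms unfolding outer_def by (subst det_add_cov[where x = "\<lambda>_. x"]) (auto simp: adjoint_colmat_mult det_single)
qed

section \<open>Positive definite and semidefinite matrices\<close>

lemma pd_det: "pd_mat n K \<Longrightarrow> det K \<noteq> 0"
proof
  assume K: "pd_mat n K" and "det K = 0"
  then obtain v where v: "v \<in> carrier_vec n" "v \<noteq> 0\<^sub>v n" "K *\<^sub>v v = 0\<^sub>v n"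
    using det_0_iff_vec_prod_zero_field[OF pd_matD(1)[OF K]] by auto
  then show False using pd_matD(3)[OF K v(1,2)] by (simp add: qform_def cip_def)
qed

text \<open>\<open>minv\<close> is \<open>the\<close> of an option, so its properties rest on the
  nonzero determinant.\<close>

lemma pd_inverse:
  assumes "pd_mat n K"
  shows "minv K \<in> carrier_mat n n" "K * minv K = 1\<^sub>m n" "minv K * K = 1\<^sub>m n"
proof -
  have c: "K \<in> carrier_mat n n" by (rule pd_matD[OF assms])
  have "K \<in> Units (ring_mat TYPE(complex) n n)" by (rule det_non_zero_imp_unit[OF c pd_det[OF assms]])
  then obtain B where B: "mat_inverse K = Some B" using mat_inverse(1)[OF c, of n] by (cases "mat_inverse K") auto
  show "minv K \<in> carrier_mat n n" "K * minv K = 1\<^sub>m n" "minv K * K = 1\<^sub>m n"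
    using mat_inverse(2)[OF c B] B by (auto simp: minv_def)
qed

lemma pd_solve:
  assumes "pd_mat n K" "h \<in> carrier_vec n"
  obtains x where "x \<in> carrier_vec n" "K *\<^sub>v x = h"
proof
  show "minv K *\<^sub>v h \<in> carrier_vec n" using pd_inverse[OF assms(1)] assms by auto
  show "K *\<^sub>v (minv K *\<^sub>v h) = h"
    using pd_inverse[OF assms(1)] pd_matD(1)[OF assms(1)] assms(2)
    by (simp add: assoc_mult_mat_vec[symmetric, of _ n n _ n])
qed

lemma pd_add_psd:
  assumes "pd_mat n K" "psd_mat n A"
  shows "pd_mat n (K + A)"
proof -
  note k = pd_matD[OF assms(1)] and a = psd_matD[OF assms(2)]
  show ?thesis unfolding pd_mat_def
    using k(1,2) a(1,2) by (auto simp: adjoint_add[of _ n n] qform_add intro!: add_pos_nonneg k(3) a(3))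
qed

lemma psd_cov: "(\<And>k. k < N \<Longrightarrow> s k \<in> carrier_vec n) \<Longrightarrow> psd_mat n (cov n N s)"
  by (rule psd_matI) (auto simp: qform_cov intro!: sum_nonneg)

lemma psd_outer: "v \<in> carrier_vec n \<Longrightarrow> psd_mat n (outer n v)"
  unfolding outer_def by (rule psd_cov)

lemma pd_one: "pd_mat n (1\<^sub>m n)"
proof -
  have "mat_adjoint (1\<^sub>m n :: complex mat) = 1\<^sub>m n" by (rule eq_matI) auto
  then show ?thesis unfolding pd_mat_def qform_def by (auto intro: cip_self_pos)
qed

lemma psd_congruence:
  assumes "H \<in> carrier_mat nr nt" "psd_mat nt A"
  shows "psd_mat nr (H * A * mat_adjoint H)"
proof (rule psd_matI)
  note a = psd_matD[OF assms(2)]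
  show "H * A * mat_adjoint H \<in> carrier_mat nr nr" using assms a by auto
  show "mat_adjoint (H * A * mat_adjoint H) = H * A * mat_adjoint H"
  proof -
    have "mat_adjoint (H * A * mat_adjoint H) = mat_adjoint (mat_adjoint H) * mat_adjoint (H * A)"
      using assms(1) a(1) by (intro adjoint_mult[of _ nr nt _ nr]) auto
    also have "mat_adjoint (H * A) = A * mat_adjoint H"
      using adjoint_mult[OF assms(1) a(1)] a(2) by simp
    finally show ?thesis
      using assms(1) a(1) by (simp add: assoc_mult_mat[of H nr nt A nt "mat_adjoint H" nr])
  qed
  show "0 \<le> qform (H * A * mat_adjoint H) v" if "v \<in> carrier_vec nr" for v
    using assms(1) a that by (auto simp: qform_congruence intro!: a(3) mult_mat_vec_carrier)
qed

subsection \<open>Successive decoding and determinants\<close>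

text \<open>Moves the last stream into the noise. Both inductions over streams run this way: the
  last stream faces \<open>K\<close> alone, and all earlier ones see it as interference.\<close>

lemma cov_Suc_assoc:
  assumes "K \<in> carrier_mat n n"
  shows "K + cov n (Suc N) h = K + outer n (h N) + cov n N h"
  unfolding cov_Suc using assms
  by (intro eq_matI) auto

lemma sum_greaterThanLessThan_Suc: "m < N \<Longrightarrow> (\<Sum>k\<in>{m<..<Suc N}. f k) = (\<Sum>k\<in>{m<..<N}. f k) + (f N :: real)"
  by (simp add: greaterThanLessThan_upt[symmetric] atLeastSucLessThan_greaterThanLessThan[symmetric] add.commute)

lemma greaterThanLessThan_Suc_self: "{N<..<Suc N} = {}"
  by auto

text \<open>Each stream multiplies the determinant by one plus its best SINR, which is at least
  \<open>g\<close>. The receiver condition is homogeneous in \<open>r\<close>, so \<open>r\<close>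
  need only be nonzero. The factor is produced as a real \<open>\<rho>\<close>, ready for the
  logarithm.\<close>

lemma sic_det_lower_bound:
  assumes g: "0 \<le> g" and "pd_mat n K" and "\<And>k. k < N \<Longrightarrow> h k \<in> carrier_vec n"
    and "\<And>m. m < N \<Longrightarrow> \<exists>r \<in> carrier_vec n. r \<noteq> 0\<^sub>v n \<and>
       g * (qform K r + (\<Sum>k\<in>{m<..<N}. (cmod (cip r (h k)))\<^sup>2)) \<le> (cmod (cip r (h m)))\<^sup>2"
  shows "\<exists>\<rho>. (1 + g) ^ N \<le> \<rho> \<and> det (K + cov n N h) = of_real \<rho> * det K"
  using assms(2-)
proof (induction N arbitrary: K)
  case 0
  then show ?case using pd_matD(1)[OF 0(1)] by (intro exI[of _ 1]) auto
next
  case (Suc N)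
  note K = pd_matD[OF Suc.prems(1)]
  have hN: "h N \<in> carrier_vec n" using Suc.prems(2) by simp
  obtain x where x: "x \<in> carrier_vec n" "K *\<^sub>v x = h N" using pd_solve[OF Suc.prems(1) hN] .
  \<comment> \<open>\<open>b\<close> equals \<open>h\<^sup>* K\<^sup>-\<^sup>1 h\<close> for the
    last stream, the upper limit for its SINR.\<close>
  define b where "b = qform K x"
  have b: "cip (h N) x = of_real b"
    using herm_form[OF K(1,2) x(1)] cip_swap[of x n "h N"] x hN unfolding b_def by simp
  obtain r where r: "r \<in> carrier_vec n" "r \<noteq> 0\<^sub>v n" "g * qform K r \<le> (cmod (cip r (h N)))\<^sup>2"
    using Suc.prems(3)[of N] unfolding greaterThanLessThan_Suc_self by auto
  have "(cmod (cip r (h N)))\<^sup>2 \<le> qform K r * b"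
    using psd_cauchy_schwarz[OF pd_imp_psd[OF Suc.prems(1)] r(1) x(1)] x(2) unfolding b_def by simp
  with r K(3)[OF r(1,2)] have gb: "g \<le> b" by (metis mult.commute mult_le_cancel_left_pos order_trans)
  let ?K = "K + outer n (h N)"
  have K': "pd_mat n ?K" by (rule pd_add_psd[OF Suc.prems(1) psd_outer[OF hN]])
  have dK': "det ?K = det K * of_real (1 + b)"
    using det_add_outer[OF K(1) x] b by simp
  \<comment> \<open>For the earlier streams, the interference from stream \<open>N\<close> passes
    from the sum into the form of \<open>?K\<close>, which gives the hypotheses of the shorter
    family.\<close>
  have "\<exists>\<rho>. (1 + g) ^ N \<le> \<rho> \<and> det (?K + cov n N h) = of_real \<rho> * det ?K"
  proof (rule Suc.IH[OF K'])
    fix m assume m: "m < N"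
    then obtain r where r: "r \<in> carrier_vec n" "r \<noteq> 0\<^sub>v n"
       "g * (qform K r + (\<Sum>k\<in>{m<..<Suc N}. (cmod (cip r (h k)))\<^sup>2)) \<le> (cmod (cip r (h m)))\<^sup>2"
      using Suc.prems(3)[of m] by auto
    have "qform ?K r = qform K r + (cmod (cip r (h N)))\<^sup>2"
      using K(1) r hN by (simp add: qform_add[of _ n] qform_outer)
    with r m show "\<exists>r \<in> carrier_vec n. r \<noteq> 0\<^sub>v n \<and>
       g * (qform ?K r + (\<Sum>k\<in>{m<..<N}. (cmod (cip r (h k)))\<^sup>2)) \<le> (cmod (cip r (h m)))\<^sup>2"
      by (intro bexI[of _ r]) (auto simp: sum_greaterThanLessThan_Suc add_ac)
  qed (use Suc.prems in auto)
  then obtain \<rho> where \<rho>: "(1 + g) ^ N \<le> \<rho>" "det (?K + cov n N h) = of_real \<rho> * det ?K" by auto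
  have "(1 + g) ^ Suc N \<le> \<rho> * (1 + b)"
  proof -
    have 1: "1 + g \<le> 1 + b" "0 \<le> 1 + g" using gb g by auto
    have "(1 + g) ^ N * (1 + g) \<le> \<rho> * (1 + b)"
      by (rule mult_mono[OF \<rho>(1) 1(1) order_trans[OF zero_le_power[OF 1(2)] \<rho>(1)] 1(2)])
    then show ?thesis unfolding power_Suc2 .
  qed
  then show ?case
    unfolding cov_Suc_assoc[OF K(1), of N h] \<rho>(2) dK' by (intro exI[of _ "\<rho> * (1 + b)"]) (simp add: mult_ac)
qed

subsection \<open>Unitary recombination of streams\<close>

text \<open>A unit vector can be completed to a unitary matrix. Here this is done by plane
  rotations: the first vectors are recombined by induction with their normalized coefficients, and
  the result is rotated against the last vector.\<close>

lemma rotate_family: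
  assumes "\<And>k. k \<le> N \<Longrightarrow> s k \<in> carrier_vec n" and "unit_cvec (Suc N) c"
  shows "\<exists>s'. (\<forall>k\<le>N. s' k \<in> carrier_vec n) \<and> cov n (Suc N) s' = cov n (Suc N) s \<and>
     s' N = colmat n (Suc N) s *\<^sub>v c"
  using assms
proof (induction N arbitrary: s c)
  case 0
  let ?t = "colmat n (Suc 0) s *\<^sub>v c"
  have c: "c \<in> carrier_vec (Suc 0)" "(cmod (c $ 0))\<^sup>2 = 1" using 0(2) by (auto simp: unit_cvec_def)
  have "c $ 0 * cnj (c $ 0) = 1" using c(2) by (metis complex_norm_square of_real_1)
  then have "cov n (Suc 0) (\<lambda>_. ?t) = cov n (Suc 0) s"
    using c by (intro cov_eqI) (auto simp: mult_mat_vec_index_sum[OF colmat_carrier c(1)] mult_ac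
        simp del: index_mult_mat_vec)
  then show ?case by (intro exI[of _ "\<lambda>_. ?t"]) (auto intro: mult_mat_vec_carrier[OF colmat_carrier c(1)])
next
  case (Suc N)
  note cu = Suc.prems(2)[unfolded unit_cvec_def]
  define r where "r = sqrt (\<Sum>i<Suc N. (cmod (c $ i))\<^sup>2)"
  have r2: "r\<^sup>2 = (\<Sum>i<Suc N. (cmod (c $ i))\<^sup>2)" unfolding r_def by (simp add: sum_nonneg)
  define a where "a = c $ Suc N"
  have ra: "r\<^sup>2 + (cmod a)\<^sup>2 = 1" using cu unfolding r2 a_def by simp
  then have ra': "of_real r * of_real r + a * cnj a = 1"
    unfolding complex_norm_square[symmetric] by (metis of_real_1 of_real_add of_real_mult power2_eq_square)
  \<comment> \<open>If the leading coefficients all vanish they cannot be normalized, but then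
    \<open>r = 0\<close> and any unit vector will do.\<close>
  obtain c' where c': "unit_cvec (Suc N) c'" "\<And>k. k < Suc N \<Longrightarrow> c $ k = of_real r * c' $ k"
  proof (cases "r = 0")
    case True
    then have "c $ k = 0" if "k < Suc N" for k
      using r2 that by (simp add: sum_nonneg_eq_0_iff del: sum.lessThan_Suc)
    moreover have "unit_cvec (Suc N) (unit_vec (Suc N) 0)"
      unfolding unit_cvec_def by (simp add: unit_vec_def if_distrib[of cmod] if_distrib[of "\<lambda>x. x\<^sup>2"] cong: if_cong del: sum.lessThan_Suc)
    ultimately show ?thesis using that True by auto
  next
    case False
    have "(\<Sum>i<Suc N. (cmod (c $ i / of_real r))\<^sup>2) = (\<Sum>i<Suc N. (cmod (c $ i))\<^sup>2) / r\<^sup>2"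
      unfolding sum_divide_distrib by (simp add: norm_divide power_divide del: sum.lessThan_Suc)
    then have "(\<Sum>i<Suc N. (cmod (c $ i / of_real r))\<^sup>2) = 1" using False unfolding r2[symmetric] by simp
    then have "unit_cvec (Suc N) (vec (Suc N) (\<lambda>i. c $ i / of_real r))"
      unfolding unit_cvec_def using False by (simp del: sum.lessThan_Suc)
    then show ?thesis using that[of "vec (Suc N) (\<lambda>i. c $ i / of_real r)"] False by simp
  qed
  obtain s1 where s1: "\<And>k. k \<le> N \<Longrightarrow> s1 k \<in> carrier_vec n" "cov n (Suc N) s1 = cov n (Suc N) s"
     "s1 N = colmat n (Suc N) s *\<^sub>v c'"
    using Suc.IH[of s c'] Suc.prems(1) c'(1) by auto
  define u where "u = s1 N"
  define w where "w = s (Suc N)"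
  have [simp]: "u \<in> carrier_vec n" "w \<in> carrier_vec n" using s1(1) Suc.prems(1) unfolding u_def w_def by auto
  have dims: "dim_vec u = n" "dim_vec w = n" using carrier_vecD[of u n] carrier_vecD[of w n] by auto
  \<comment> \<open>The coefficient rows \<open>(cnj a, - r)\<close> and \<open>(r, a)\<close> are
    orthonormal because \<open>r\<^sup>2 + |a|\<^sup>2 = 1\<close>, so the sum of the two outer
    products is unchanged.\<close>
  define s' where "s' = s1(N := cnj a \<cdot>\<^sub>v u - of_real r \<cdot>\<^sub>v w, Suc N := of_real r \<cdot>\<^sub>v u + a \<cdot>\<^sub>v w)"
  have two: "(cnj a * ui - of_real r * wi) * cnj (cnj a * uj - of_real r * wj)
     + (of_real r * ui + a * wi) * cnj (of_real r * uj + a * wj) = ui * cnj uj + wi * cnj wj" for ui uj wi wj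
  proof -
    have "(cnj a * ui - of_real r * wi) * cnj (cnj a * uj - of_real r * wj)
     + (of_real r * ui + a * wi) * cnj (of_real r * uj + a * wj) =
       (of_real r * of_real r + a * cnj a) * (ui * cnj uj + wi * cnj wj)"
      by (simp add: algebra_simps)
    then show ?thesis using ra' by simp
  qed
  have "cov n (Suc (Suc N)) s' = cov n (Suc (Suc N)) s"
  proof (rule cov_eqI)
    fix i j assume ij: "i < n" "j < n"
    have "(\<Sum>k<Suc (Suc N). s' k $ i * cnj (s' k $ j)) = (\<Sum>k<N. s1 k $ i * cnj (s1 k $ j))
        + (s' N $ i * cnj (s' N $ j) + s' (Suc N) $ i * cnj (s' (Suc N) $ j))"
      by (simp add: s'_def add.assoc)
    also have "s' N $ i * cnj (s' N $ j) + s' (Suc N) $ i * cnj (s' (Suc N) $ j)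
        = u $ i * cnj (u $ j) + w $ i * cnj (w $ j)"
      using two[of "u $ i" "w $ i" "u $ j" "w $ j"] ij by (simp add: s'_def dims)
    also have "(\<Sum>k<N. s1 k $ i * cnj (s1 k $ j)) + (u $ i * cnj (u $ j) + w $ i * cnj (w $ j)) =
        cov n (Suc N) s1 $$ (i, j) + w $ i * cnj (w $ j)"
      using ij by (simp add: cov_index u_def)
    also have "\<dots> = (\<Sum>k<Suc (Suc N). s k $ i * cnj (s k $ j))"
      unfolding s1(2) using ij by (simp add: cov_index w_def)
    finally show "(\<Sum>k<Suc (Suc N). s' k $ i * cnj (s' k $ j)) = (\<Sum>k<Suc (Suc N). s k $ i * cnj (s k $ j))" .
  qed
  moreover have "s' (Suc N) = colmat n (Suc (Suc N)) s *\<^sub>v c"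
  proof (rule eq_vecI)
    fix i assume "i < dim_vec (colmat n (Suc (Suc N)) s *\<^sub>v c)"
    then have i: "i < n" by simp
    have cc: "c \<in> carrier_vec (Suc (Suc N))" "c' \<in> carrier_vec (Suc N)" using cu c'(1) by (auto simp: unit_cvec_def)
    have "(colmat n (Suc (Suc N)) s *\<^sub>v c) $ i = (\<Sum>k<Suc N. s k $ i * c $ k) + w $ i * a"
      using i by (simp add: mult_mat_vec_index_sum[OF colmat_carrier cc(1)] w_def a_def del: index_mult_mat_vec)
    also have "(\<Sum>k<Suc N. s k $ i * c $ k) = of_real r * u $ i"
      unfolding u_def s1(3) using i
      by (simp add: mult_mat_vec_index_sum[OF colmat_carrier cc(2)] c'(2) sum_distrib_left mult_ac
          del: index_mult_mat_vec sum.lessThan_Suc)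
    finally show "s' (Suc N) $ i = (colmat n (Suc (Suc N)) s *\<^sub>v c) $ i"
      using i by (simp add: s'_def dims mult.commute del: index_mult_mat_vec)
  qed (auto simp: s'_def dims)
  moreover have "\<forall>k\<le>Suc N. s' k \<in> carrier_vec n" using s1(1) by (auto simp: s'_def)
  ultimately show ?case by blast
qed

section \<open>Prescribing the value of a Hermitian form on a unit vector\<close>

lemma prod_list_less_power:
  "xs \<noteq> [] \<Longrightarrow> (\<And>x. x \<in> set xs \<Longrightarrow> 0 \<le> x \<and> x < (d :: real)) \<Longrightarrow> prod_list xs < d ^ length xs \<and> 0 \<le> prod_list xs"
proof (induction xs)
  case (Cons a xs)
  then show ?case by (cases "xs = []") (auto intro!: mult_strict_mono')
qed simp

lemma prod_list_greater_power:
  "xs \<noteq> [] \<Longrightarrow> 0 < d \<Longrightarrow> (\<And>x. x \<in> set xs \<Longrightarrow> (d :: real) < x) \<Longrightarrow> d ^ length xs < prod_list xs"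
proof (induction xs)
  case (Cons a xs)
  then show ?case by (cases "xs = []") (auto intro!: mult_strict_mono intro: less_trans)
qed simp

text \<open>Schur triangularization puts the roots of the characteristic polynomial, with
  multiplicity, on the diagonal of a similar matrix.\<close>

lemma det_prod_eigenvalues:
  assumes A: "(A :: complex mat) \<in> carrier_mat n n"
  obtains as where "det A = prod_list as" "length as = n" "\<And>a. a \<in> set as \<Longrightarrow> eigenvalue A a"
proof -
  obtain as where as: "char_poly A = (\<Prod>a\<leftarrow>as. [:- a, 1:])" "length as = n"
    using char_poly_factorized[OF A] by auto
  obtain B P Q where dec: "schur_decomposition A as = (B, P, Q)" by (cases "schur_decomposition A as")
  from schur_decomposition[OF A as(1) dec]
  have B: "similar_mat_wit A B P Q" "upper_triangular B" "diag_mat B = as" by auto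
  have "det A = det B" using det_similar B(1) unfolding similar_mat_def by blast
  also have "\<dots> = prod_list as"
    using det_upper_triangular[OF B(2)] similar_mat_witD2[OF A B(1)] B(3) by blast
  finally show thesis
    using as by (intro that) (auto simp: eigenvalue_root_char_poly[OF A] poly_prod_list prod_list_zero_iff)
qed

lemma psd_eigenvalue:
  assumes A: "psd_mat n A" and ev: "eigenvalue A a"
  obtains u where "unit_cvec n u" "A *\<^sub>v u = complex_of_real (Re a) \<cdot>\<^sub>v u" "qform A u = Re a" "0 \<le> Re a" "a = of_real (Re a)"
proof -
  note a = psd_matD[OF A]
  obtain v where v: "v \<in> carrier_vec n" "v \<noteq> 0\<^sub>v n" "A *\<^sub>v v = a \<cdot>\<^sub>v v"
    using ev a(1) unfolding eigenvalue_def eigenvector_def by auto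
  define u where "u = complex_of_real (1 / sqrt (Re (cip v v))) \<cdot>\<^sub>v v"
  have u: "unit_cvec n u" unfolding u_def by (rule normalize_unit[OF v(1,2)])
  then have uc: "u \<in> carrier_vec n" "cip u u = 1" unfolding unit_cvec_iff by auto
  have Au: "A *\<^sub>v u = a \<cdot>\<^sub>v u"
    using v a(1) unfolding u_def by (simp add: mult_mat_vec[of A n n] smult_smult_assoc mult.commute)
  have "a = of_real (qform A u)"
    using herm_form[OF a(1,2) uc(1)] uc unfolding Au by (simp add: cip_smult_right[where n = n])
  then have q: "qform A u = Re a" "a = of_real (Re a)" by (metis Re_complex_of_real)+
  show thesis using that[OF u] q Au a(3)[OF uc(1)] by simp
qed

text \<open>\<open>d\<close> is the geometric mean of the eigenvalues, so two of them enclose it.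
  Unless one equals \<open>d\<close>, an explicit combination of their eigenvectors is used in place
  of a connectedness argument.\<close>

lemma psd_unit_form_value:
  assumes G: "psd_mat N G" and det: "det G = of_real (d ^ N)" and d: "0 < d" and N: "0 < N"
  obtains c where "unit_cvec N c" "qform G c = d"
proof -
  note g = psd_matD[OF G]
  obtain as where as: "det G = prod_list as" "length as = N" "\<And>a. a \<in> set as \<Longrightarrow> eigenvalue G a"
    using det_prod_eigenvalues[OF g(1)] by blast
  have real: "a = of_real (Re a)" "0 \<le> Re a" if "a \<in> set as" for a
    using psd_eigenvalue[OF G as(3)[OF that]] by auto
  have "prod_list as = of_real (prod_list (map Re as))"
    using real(1) by (induction as) auto
  then have p: "prod_list (map Re as) = d ^ N" using det as(1) by (metis of_real_eq_iff)
  have ne: "map Re as \<noteq> []" using as(2) N by auto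
  obtain a1 where a1: "a1 \<in> set as" "Re a1 \<le> d"
    using prod_list_greater_power[OF ne d] p as(2) by (force simp: not_le[symmetric])
  obtain a2 where a2: "a2 \<in> set as" "d \<le> Re a2"
    using prod_list_less_power[OF ne, of d] p as(2) real(2) by (force simp: not_le[symmetric])
  define x y where "x = Re a1" and "y = Re a2"
  obtain u where u: "unit_cvec N u" "G *\<^sub>v u = complex_of_real x \<cdot>\<^sub>v u" "qform G u = x"
    using psd_eigenvalue[OF G as(3)[OF a1(1)]] unfolding x_def by metis
  obtain w where w: "unit_cvec N w" "G *\<^sub>v w = complex_of_real y \<cdot>\<^sub>v w" "qform G w = y"
    using psd_eigenvalue[OF G as(3)[OF a2(1)]] unfolding y_def by metis
  have uc: "u \<in> carrier_vec N" "cip u u = 1" and wc: "w \<in> carrier_vec N" "cip w w = 1"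
    using u(1) w(1) unfolding unit_cvec_iff by auto
  show thesis
  proof (cases "x = d \<or> y = d")
    case True
    then show ?thesis using that u w by auto
  next
    case False
    then have xy: "x < d" "d < y" using a1 a2 unfolding x_def y_def by auto
    have "of_real y * cip u w = cip u (G *\<^sub>v w)" using w uc wc by (simp add: cip_smult_right[where n = N])
    also have "\<dots> = cip (G *\<^sub>v u) w" using cip_adjoint[OF g(1) uc(1) wc(1)] g(2) by simp
    also have "\<dots> = of_real x * cip u w" using u uc wc by (simp add: cip_smult_left[where n = N])
    finally have orth: "cip u w = 0" using xy by simp
    \<comment> \<open>These weights solve \<open>\<alpha>\<^sup>2 + \<beta>\<^sup>2 = 1\<close> and
      \<open>\<alpha>\<^sup>2 x + \<beta>\<^sup>2 y = d\<close>; orthogonality of \<open>u\<close>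
      and \<open>w\<close> removes the cross terms.\<close>
    define \<alpha> \<beta> where "\<alpha> = sqrt ((y - d) / (y - x))" and "\<beta> = sqrt ((d - x) / (y - x))"
    have ab: "\<alpha>\<^sup>2 = (y - d) / (y - x)" "\<beta>\<^sup>2 = (d - x) / (y - x)" unfolding \<alpha>_def \<beta>_def using xy by auto
    define c where "c = complex_of_real \<alpha> \<cdot>\<^sub>v u + complex_of_real \<beta> \<cdot>\<^sub>v w"
    have cc: "c \<in> carrier_vec N" using uc wc unfolding c_def by auto
    have one: "\<alpha>\<^sup>2 + \<beta>\<^sup>2 = 1" unfolding ab add_divide_distrib[symmetric] using xy by simp
    have "cip c c = of_real (\<alpha>\<^sup>2 + \<beta>\<^sup>2)"
      using uc wc orth cip_swap[OF uc(1) wc(1)] unfolding c_def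
      by (simp add: cip_add_left[where n = N] cip_add_right[where n = N] cip_smult_left[where n = N]
          cip_smult_right[where n = N] power2_eq_square)
    then have unit: "unit_cvec N c" unfolding unit_cvec_iff one using cc by simp
    have "qform G c = \<alpha>\<^sup>2 * x + \<beta>\<^sup>2 * y"
      unfolding c_def qform_comb[OF g(1,2) uc(1) wc(1)] u(3) w(2,3)
      using uc wc orth by (simp add: cip_smult_right[where n = N])
    also have "\<dots> = ((y - d) * x + (d - x) * y) / (y - x)"
      unfolding ab by (simp add: add_divide_distrib)
    also have "(y - d) * x + (d - x) * y = d * (y - x)" by (simp add: algebra_simps)
    finally have "qform G c = d" using xy by simp
    then show ?thesis using that unit by blast
  qed
qed

text \<open>Streams are fixed from the last to the first. The last one is made to multiply the
  determinant by exactly \<open>d\<close>, which leaves the factor \<open>d ^ N\<close> for the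
  others against the enlarged noise, so the induction closes.\<close>

lemma equal_sinr_streams:
  assumes d: "1 < d" and H: "H \<in> carrier_mat nr nt"
    and "pd_mat nr K" and "\<And>k. k < N \<Longrightarrow> s k \<in> carrier_vec nt"
    and "det (K + cov nr N (\<lambda>k. H *\<^sub>v s k)) = of_real (d ^ N) * det K"
  shows "\<exists>s' R. (\<forall>k<N. s' k \<in> carrier_vec nt \<and> unit_cvec nr (R k)) \<and> cov nt N s' = cov nt N s \<and>
     (\<forall>m<N. (d - 1) * (qform K (R m) + (\<Sum>k\<in>{m<..<N}. (cmod (cip (R m) (H *\<^sub>v s' k)))\<^sup>2))
        \<le> (cmod (cip (R m) (H *\<^sub>v s' m)))\<^sup>2)"
  using assms(3-)
proof (induction N arbitrary: K s)
  case 0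
  then show ?case by simp
next
  case (Suc N)
  note K = pd_matD[OF Suc.prems(1)]
  note s = Suc.prems(2)
  let ?h = "\<lambda>k. H *\<^sub>v s k" and ?x = "\<lambda>k. minv K *\<^sub>v (H *\<^sub>v s k)"
  have hc: "?h k \<in> carrier_vec nr" if "k < Suc N" for k using H s[OF that] by auto
  have xc: "?x k \<in> carrier_vec nr" if "k < Suc N" for k
    using pd_inverse[OF Suc.prems(1)] hc[OF that] by auto
  have Kx: "K *\<^sub>v ?x k = ?h k" if "k < Suc N" for k
    using pd_inverse[OF Suc.prems(1)] K(1) hc[OF that]
    by (simp add: assoc_mult_mat_vec[symmetric, of _ nr nr _ nr])
  let ?X = "colmat nr (Suc N) ?x" and ?S = "colmat nr (Suc N) ?h"
  have KX: "K * ?X = ?S"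
    by (subst mult_colmat[OF K(1)]) (auto simp: xc Kx intro!: eq_matI simp del: index_mult_mat_vec)
  \<comment> \<open>The Gram matrix with entries
    \<open>h\<^sub>i\<^sup>* K\<^sup>-\<^sup>1 h\<^sub>j\<close>, written as a congruence of
    \<open>K\<close>; the double adjoint matches the shape in \<open>psd_congruence\<close>.\<close>
  define P where "P = mat_adjoint ?X * K * mat_adjoint (mat_adjoint ?X)"
  have P: "psd_mat (Suc N) P"
    unfolding P_def by (rule psd_congruence[of _ _ nr]) (auto intro: pd_imp_psd Suc.prems)
  have "mat_adjoint ?S = mat_adjoint ?X * K"
    unfolding KX[symmetric] using adjoint_mult[OF K(1) colmat_carrier] K(2) by simp
  then have detG: "det (K + cov nr (Suc N) ?h) = det K * det (1\<^sub>m (Suc N) + P)"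
    using det_add_cov[OF K(1) xc Kx] unfolding P_def by simp
  have G: "psd_mat (Suc N) (1\<^sub>m (Suc N) + P)"
    by (intro pd_imp_psd pd_add_psd pd_one P)
  obtain c where c: "unit_cvec (Suc N) c" "qform (1\<^sub>m (Suc N) + P) c = d"
  proof (rule psd_unit_form_value[OF G])
    show "det (1\<^sub>m (Suc N) + P) = of_real (d ^ Suc N)"
      using detG Suc.prems(3) pd_det[OF Suc.prems(1)] by simp
  qed (use d in auto)
  have cc: "c \<in> carrier_vec (Suc N)" "cip c c = 1" using c(1) unfolding unit_cvec_iff by auto
  \<comment> \<open>\<open>y\<close> turns out to be \<open>K\<^sup>-\<^sup>1\<close> applied to the
    new last received vector (\<open>hNy\<close>), and its form value \<open>d - 1\<close> is the
    SINR of that stream.\<close>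
  define y where "y = ?X *\<^sub>v c"
  have y: "y \<in> carrier_vec nr" unfolding y_def by (rule mult_mat_vec_carrier[OF colmat_carrier cc(1)])
  have "d = 1 + qform P c"
    using c(2) cc psd_matD(1)[OF P] by (simp add: qform_add[of _ "Suc N"] qform_def[of "1\<^sub>m _"])
  also have "qform P c = qform K y"
    unfolding P_def y_def using K(1) cc(1) by (subst qform_congruence[of _ _ nr]) auto
  finally have qy: "qform K y = d - 1" by simp
  obtain s1 where s1: "\<And>k. k \<le> N \<Longrightarrow> s1 k \<in> carrier_vec nt" "cov nt (Suc N) s1 = cov nt (Suc N) s"
     "s1 N = colmat nt (Suc N) s *\<^sub>v c"
    using rotate_family[of N s nt c] s c(1) by auto
  define hN where "hN = H *\<^sub>v s1 N"
  have hNc: "hN \<in> carrier_vec nr" using H s1(1)[of N] unfolding hN_def by auto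
  have hNy: "K *\<^sub>v y = hN"
  proof -
    have "K *\<^sub>v y = ?S *\<^sub>v c"
      unfolding y_def KX[symmetric] using K(1) cc(1) by (intro assoc_mult_mat_vec[symmetric, of _ nr nr _ "Suc N"]) auto
    also have "?S = H * colmat nt (Suc N) s" using mult_colmat[OF H s] by simp
    also have "\<dots> *\<^sub>v c = hN"
      unfolding hN_def s1(3) using H cc(1) by (intro assoc_mult_mat_vec[of _ nr nt _ "Suc N"]) auto
    finally show ?thesis .
  qed
  have hy: "cip hN y = of_real (d - 1)"
    using herm_form[OF K(1,2) y] cip_swap[OF y hNc] unfolding hNy qy by simp
  let ?K = "K + outer nr hN"
  have K': "pd_mat nr ?K" by (rule pd_add_psd[OF Suc.prems(1) psd_outer[OF hNc]])
  have dK': "det ?K = det K * of_real d"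
    using det_add_outer[OF K(1) y hNy] hy by simp
  have "cov nr (Suc N) (\<lambda>k. H *\<^sub>v s1 k) = H * cov nt (Suc N) s1 * mat_adjoint H"
    using s1(1) by (intro congruence_cov[OF H, symmetric]) auto
  also have "\<dots> = cov nr (Suc N) ?h"
    unfolding s1(2) by (rule congruence_cov[OF H s])
  finally have "det (?K + cov nr N (\<lambda>k. H *\<^sub>v s1 k)) = of_real (d ^ Suc N) * det K"
    using Suc.prems(3) unfolding cov_Suc_assoc[OF K(1), of N "\<lambda>k. H *\<^sub>v s1 k", folded hN_def, symmetric] by simp
  then have "det (?K + cov nr N (\<lambda>k. H *\<^sub>v s1 k)) = of_real (d ^ N) * det ?K"
    unfolding dK' by simp
  \<comment> \<open>Only the first \<open>N\<close> vectors are recombined further; the last stream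
    and the total covariance stay fixed.\<close>
  from Suc.IH[OF K' _ this] s1(1) obtain s2 R where s2:
    "\<And>k. k < N \<Longrightarrow> s2 k \<in> carrier_vec nt" "\<And>k. k < N \<Longrightarrow> unit_cvec nr (R k)" "cov nt N s2 = cov nt N s1"
    "\<And>m. m < N \<Longrightarrow> (d - 1) * (qform ?K (R m) + (\<Sum>k\<in>{m<..<N}. (cmod (cip (R m) (H *\<^sub>v s2 k)))\<^sup>2))
        \<le> (cmod (cip (R m) (H *\<^sub>v s2 m)))\<^sup>2"
    by auto
  have y0: "y \<noteq> 0\<^sub>v nr" using qy d K(1) by (auto simp: qform_def cip_def)
  define \<alpha> where "\<alpha> = 1 / sqrt (Re (cip y y))"
  \<comment> \<open>The receiver is the normalized MMSE direction \<open>y\<close>; both sides of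
    its SINR inequality become \<open>\<alpha>\<^sup>2 (d - 1)\<^sup>2\<close>.\<close>
  define z where "z = complex_of_real \<alpha> \<cdot>\<^sub>v y"
  have z: "unit_cvec nr z" unfolding z_def \<alpha>_def by (rule normalize_unit[OF y y0])
  have "cip z hN = of_real (\<alpha> * (d - 1))"
    unfolding z_def using y hNc hy cip_swap[OF hNc y] by (simp add: cip_smult_left[where n = nr])
  then have gz: "(cmod (cip z hN))\<^sup>2 = \<alpha>\<^sup>2 * (d - 1)\<^sup>2" 
    by (simp only: norm_of_real power2_abs power_mult_distrib)
  have "K *\<^sub>v z = complex_of_real \<alpha> \<cdot>\<^sub>v hN"
    unfolding z_def using K(1) y hNy by (simp add: mult_mat_vec[of K nr nr])
  then have qz: "qform K z = \<alpha>\<^sup>2 * (d - 1)"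
    unfolding qform_def z_def using y hNc hy cip_swap[OF hNc y]
    by (simp add: cip_smult_left[where n = nr] cip_smult_right[where n = nr] power2_eq_square)
  let ?s = "s2(N := s1 N)" and ?R = "R(N := z)"
  have "cov nt (Suc N) ?s = cov nt (Suc N) s1"
    unfolding cov_Suc using s2(3) cov_cong[of N ?s s2 nt] by simp
  then have "cov nt (Suc N) ?s = cov nt (Suc N) s" unfolding s1(2) .
  moreover have "\<forall>k<Suc N. ?s k \<in> carrier_vec nt \<and> unit_cvec nr (?R k)"
    using s2(1,2) s1(1) z by (auto simp: less_Suc_eq)
  moreover have "(d - 1) * (qform K (?R m) + (\<Sum>k\<in>{m<..<Suc N}. (cmod (cip (?R m) (H *\<^sub>v ?s k)))\<^sup>2))
        \<le> (cmod (cip (?R m) (H *\<^sub>v ?s m)))\<^sup>2" if "m < Suc N" for m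
  proof (cases "m = N")
    case True
    then show ?thesis
      using gz qz by (simp add: greaterThanLessThan_Suc_self flip: hN_def) (simp add: power2_eq_square)
  next
    case False
    then have m: "m < N" using that by simp
    then have Rm: "R m \<in> carrier_vec nr" using s2(2) unfolding unit_cvec_def by auto
    have "qform ?K (R m) = qform K (R m) + (cmod (cip (R m) hN))\<^sup>2"
      using K(1) Rm hNc by (simp add: qform_add[of _ nr] qform_outer)
    then show ?thesis
      using s2(4)[OF m] m by (simp add: sum_greaterThanLessThan_Suc hN_def add_ac)
  qed
  ultimately show ?case by blast
qed

subsection \<open>Rank reduction of the transmit covariance\<close>

text \<open>One step of Cholesky elimination:
  \<open>B = A - A v v\<^sup>* A / (v\<^sup>* A v)\<close>. Cauchy-Schwarz keeps \<open>B\<close>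
  positive semidefinite, and the kernel of \<open>A\<close> survives because \<open>s\<close> is a
  multiple of \<open>A v\<close>.\<close>

lemma psd_peel:
  assumes A: "psd_mat n A" and v: "v \<in> carrier_vec n"
  shows "\<exists>s B. s \<in> carrier_vec n \<and> psd_mat n B \<and> A = B + outer n s \<and> B *\<^sub>v v = 0\<^sub>v n \<and>
     (\<forall>u \<in> carrier_vec n. A *\<^sub>v u = 0\<^sub>v n \<longrightarrow> B *\<^sub>v u = 0\<^sub>v n)"
proof (cases "qform A v = 0")
  case True
  \<comment> \<open>Here \<open>v\<close> is already in the kernel, so the zero vector is peeled
    off.\<close>
  have "outer n (0\<^sub>v n) = 0\<^sub>m n n" by (rule eq_matI) (auto simp: outer_index)
  then show ?thesis using A psd_kernel[OF A v True] psd_matD(1)[OF A]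
    by (intro exI[of _ "0\<^sub>v n"] exI[of _ A]) auto
next
  case False
  note a = psd_matD[OF A]
  define q where "q = qform A v"
  have q: "0 < q" using a(3)[OF v] False unfolding q_def by simp
  have Av: "A *\<^sub>v v \<in> carrier_vec n" using a(1) v by auto
  define s where "s = complex_of_real (1 / sqrt q) \<cdot>\<^sub>v (A *\<^sub>v v)"
  have s: "s \<in> carrier_vec n" using Av unfolding s_def by auto
  have su: "cip s u = of_real (1 / sqrt q) * cip v (A *\<^sub>v u)" if "u \<in> carrier_vec n" for u
    using cip_adjoint[OF a(1) v that] a(2) Av that unfolding s_def by (simp add: cip_smult_left[where n = n])
  define B where "B = A - outer n s"
  have Bc: "B \<in> carrier_mat n n" unfolding B_def by (rule minus_carrier_mat) simp
  have AB: "A = B + outer n s" unfolding B_def using a(1) by (intro eq_matI) auto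
  have Ah: "A $$ (i, j) = cnj (A $$ (j, i))" if "i < n" "j < n" for i j
    using a(1,2) that by (metis adjoint_index carrier_matD)
  have Bh: "mat_adjoint B = B"
  proof (rule eq_matI)
    fix i j assume "i < dim_row B" "j < dim_col B"
    then have ij: "i < n" "j < n" using Bc by auto
    then show "mat_adjoint B $$ (i, j) = B $$ (i, j)"
      using Bc Ah[OF ij] a(1) unfolding B_def by (simp add: outer_index)
  qed (use Bc in auto)
  have Bu: "B *\<^sub>v u = A *\<^sub>v u - cip s u \<cdot>\<^sub>v s" if "u \<in> carrier_vec n" for u
    unfolding B_def using a(1) that s by (simp add: minus_mult_distrib_mat_vec[of _ n n] outer_mult_vec)
  have qB: "0 \<le> qform B w" if w: "w \<in> carrier_vec n" for w
  proof -
    have "qform A w = qform B w + qform (outer n s) w"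
      by (subst AB, rule qform_add) (use Bc w in auto)
    also have "qform (outer n s) w = (cmod (cip w s))\<^sup>2" using s w by (rule qform_outer)
    also have "\<dots> = (cmod (cip w (A *\<^sub>v v)))\<^sup>2 / q"
      unfolding s_def using Av w q by (simp add: cip_smult_right[where n = n] norm_divide power_divide)
    also have "\<dots> \<le> qform A w"
      using psd_cauchy_schwarz[OF A w v] q unfolding q_def by (simp add: field_simps)
    finally show ?thesis by simp
  qed
  have "B *\<^sub>v v = 0\<^sub>v n"
  proof -
    have sq: "complex_of_real (sqrt q) * complex_of_real (sqrt q) = of_real q"
      using q by (simp flip: of_real_mult)
    have "cip s v \<cdot>\<^sub>v s = A *\<^sub>v v"
      unfolding su[OF v] herm_form[OF a(1,2) v] q_def[symmetric] unfolding s_def using q sq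
      by (simp add: smult_smult_assoc)
    then show ?thesis using Bu[OF v] Av by simp
  qed
  moreover have "B *\<^sub>v u = 0\<^sub>v n" if "u \<in> carrier_vec n" "A *\<^sub>v u = 0\<^sub>v n" for u
    using Bu[OF that(1)] su[OF that(1)] that s v by (auto simp: cip_def)
  moreover have "psd_mat n B" by (rule psd_matI[OF Bc Bh qB])
  ultimately show ?thesis using s AB by blast
qed

text \<open>Peeling along one vector after another works because each step preserves the kernel
  gained so far.\<close>

lemma psd_peel_family:
  assumes A: "psd_mat n A" and "\<And>k. k < M \<Longrightarrow> v k \<in> carrier_vec n"
  shows "\<exists>s B. (\<forall>k<M. s k \<in> carrier_vec n) \<and> psd_mat n B \<and> A = B + cov n M s \<and> (\<forall>k<M. B *\<^sub>v v k = 0\<^sub>v n)"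
  using assms(2)
proof (induction M)
  case 0
  then show ?case using A psd_matD(1)[OF A] by (intro exI[of _ undefined] exI[of _ A]) auto
next
  case (Suc M)
  then obtain s B where B: "\<forall>k<M. s k \<in> carrier_vec n" "psd_mat n B" "A = B + cov n M s" "\<forall>k<M. B *\<^sub>v v k = 0\<^sub>v n"
    by auto
  obtain t C where C: "t \<in> carrier_vec n" "psd_mat n C" "B = C + outer n t" "C *\<^sub>v v M = 0\<^sub>v n"
     "\<forall>u \<in> carrier_vec n. B *\<^sub>v u = 0\<^sub>v n \<longrightarrow> C *\<^sub>v u = 0\<^sub>v n"
    using psd_peel[OF B(2), of "v M"] Suc.prems by auto
  have "A = C + cov n (Suc M) (s(M := t))"
    unfolding cov_Suc B(3) C(3) using psd_matD(1)[OF C(2)] cov_cong[of M "s(M := t)" s n]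
    by (intro eq_matI) auto
  moreover have "\<forall>k<Suc M. (s(M := t)) k \<in> carrier_vec n" using B(1) C(1) by (simp add: less_Suc_eq)
  moreover have "\<forall>k<Suc M. C *\<^sub>v v k = 0\<^sub>v n" using B(4) C(4,5) Suc.prems by (simp add: less_Suc_eq)
  ultimately show ?case using C(2) by blast
qed

section \<open>Rank factorization and its use for covariances\<close>

lemma (in vec_space) col_in_span_maximal:
  assumes A: "A \<in> carrier_mat n nc" and S: "maximal S (\<lambda>T. T \<subseteq> set (cols A) \<and> lin_indpt T)" and x: "x \<in> set (cols A)"
  shows "x \<in> span S"
proof (rule ccontr)
  assume nx: "x \<notin> span S"
  have c: "set (cols A) \<subseteq> carrier_vec n" using cols_dim A by blast
  have S1: "S \<subseteq> set (cols A)" "lin_indpt S" using S unfolding maximal_def by auto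
  then have Sc: "S \<subseteq> carrier_vec n" using c by auto
  have "x \<notin> S" using nx span_mem[OF Sc] by auto
  have "lin_indpt (S \<union> {x})"
    using lin_dep_iff_in_span[OF Sc S1(2)] x c nx \<open>x \<notin> S\<close> by auto
  then have "S \<union> {x} = S"
    using S S1 x unfolding maximal_def by blast
  then show False using \<open>x \<notin> S\<close> by auto
qed

text \<open>A maximal independent set of columns supplies \<open>w\<close>, and the coordinates of
  all columns in it supply \<open>c\<close>. The rows \<open>c k\<close> therefore span the row
  space.\<close>

lemma rank_factorization:
  assumes A: "A \<in> carrier_mat nr nc"
  obtains w c :: "nat \<Rightarrow> nat \<Rightarrow> complex"
  where "\<And>i j. i < nr \<Longrightarrow> j < nc \<Longrightarrow> A $$ (i, j) = (\<Sum>k<mrank A. w k i * c k j)"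
proof -
  interpret vec_space "TYPE(complex)" nr .
  have c: "set (cols A) \<subseteq> carrier_vec nr" using cols_dim A by blast
  have "lin_indpt {}" by (simp add: lin_dep_def)
  then obtain S where S: "finite S" "maximal S (\<lambda>T. T \<subseteq> set (cols A) \<and> lin_indpt T)"
    using maximal_exists_superset[of "set (cols A)" "\<lambda>T. T \<subseteq> set (cols A) \<and> lin_indpt T" "{}"] by auto
  have M: "mrank A = card S" unfolding mrank_def using rank_card_indpt[OF A S(2)] A by auto
  have Sc: "S \<subseteq> carrier_vec nr" using S(2) c unfolding maximal_def by auto
  obtain b where b: "bij_betw b {..<card S} S" using ex_bij_betw_nat_finite[OF S(1)] by (auto simp: atLeast0LessThan)
  have "\<exists>a. col A j = lincomb a S" if "j < nc" for j
  proof -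
    have "col A j \<in> span S" using col_in_span_maximal[OF A S(2), of "col A j"] A that by (auto simp: cols_def)
    then show ?thesis using finite_in_span[OF S(1) Sc] by metis
  qed
  then obtain a where a: "\<And>j. j < nc \<Longrightarrow> col A j = lincomb (a j) S" by metis
  show thesis
  proof (rule that[of "\<lambda>k i. b k $ i" "\<lambda>k j. a j (b k)"])
    fix i j assume ij: "i < nr" "j < nc"
    have "A $$ (i, j) = col A j $ i" using ij A by simp
    also have "\<dots> = (\<Sum>x\<in>S. a j x * x $ i)" unfolding a[OF ij(2)] by (rule lincomb_index[OF ij(1) Sc])
    also have "\<dots> = (\<Sum>k<card S. a j (b k) * b k $ i)" by (rule sum.reindex_bij_betw[OF b, symmetric])
    finally show "A $$ (i, j) = (\<Sum>k<mrank A. b k $ i * a j (b k))" by (simp add: M mult.commute)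
  qed
qed

lemma mrank_pos:
  assumes "A \<in> carrier_mat nr nc" "A \<noteq> 0\<^sub>m nr nc"
  shows "0 < mrank A"
proof (rule ccontr)
  assume "\<not> 0 < mrank A"
  then have 0: "mrank A = 0" by simp
  obtain w c :: "nat \<Rightarrow> nat \<Rightarrow> complex" where "\<And>i j. i < nr \<Longrightarrow> j < nc \<Longrightarrow> A $$ (i, j) = (\<Sum>k<mrank A. w k i * c k j)"
    using rank_factorization[OF assms(1)] by blast
  then have "A = 0\<^sub>m nr nc" using assms(1) by (intro eq_matI) (auto simp: 0)
  then show False using assms by simp
qed

text \<open>Peeling along the row space of \<open>H\<close> leaves a remainder with
  \<open>B H\<^sup>* = 0\<close>, invisible at the own receiver. Since \<open>B\<close> is positive
  semidefinite, dropping it can only save power and lower interference elsewhere.\<close>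

lemma rank_reduced_covariance:
  assumes H: "H \<in> carrier_mat nr nt" and A: "psd_mat nt A"
  obtains s B where "\<And>k. k < mrank H \<Longrightarrow> s k \<in> carrier_vec nt" "psd_mat nt B" "A = B + cov nt (mrank H) s"
    "H * A * mat_adjoint H = cov nr (mrank H) (\<lambda>k. H *\<^sub>v s k)"
proof -
  obtain w c :: "nat \<Rightarrow> nat \<Rightarrow> complex"
    where wc: "\<And>i j. i < nr \<Longrightarrow> j < nt \<Longrightarrow> H $$ (i, j) = (\<Sum>k<mrank H. w k i * c k j)"
    using rank_factorization[OF H] by blast
  \<comment> \<open>Conjugated, because the columns of \<open>H\<^sup>*\<close> are combinations of
    the conjugates of the rows \<open>c k\<close>.\<close>
  define v where "v k = vec nt (\<lambda>j. cnj (c k j))" for k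
  obtain s B where B: "\<forall>k<mrank H. s k \<in> carrier_vec nt" "psd_mat nt B" "A = B + cov nt (mrank H) s"
     "\<forall>k<mrank H. B *\<^sub>v v k = 0\<^sub>v nt"
    using psd_peel_family[OF A, of "mrank H" v] by (auto simp: v_def)
  have Bc: "B \<in> carrier_mat nt nt" by (rule psd_matD[OF B(2)])
  have Ha: "mat_adjoint H \<in> carrier_mat nt nr" using H by simp
  have BH: "B * mat_adjoint H = 0\<^sub>m nt nr"
  proof (rule eq_matI)
    fix a i assume "a < dim_row (0\<^sub>m nt nr :: complex mat)" "i < dim_col (0\<^sub>m nt nr :: complex mat)"
    then have ai: "a < nt" "i < nr" by auto
    have z: "(\<Sum>j<nt. B $$ (a, j) * cnj (c k j)) = 0" if "k < mrank H" for k
    proof -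
      have "(B *\<^sub>v v k) $ a = (\<Sum>j<nt. B $$ (a, j) * v k $ j)"
        by (rule mult_mat_vec_index_sum[OF Bc _ ai(1)]) (simp add: v_def)
      moreover have "(B *\<^sub>v v k) $ a = 0" using B(4) that ai by simp
      ultimately show ?thesis by (simp add: v_def)
    qed
    have "(B * mat_adjoint H) $$ (a, i) = (\<Sum>j<nt. B $$ (a, j) * cnj (H $$ (i, j)))"
      using ai H by (simp add: mult_mat_index_sum[OF Bc Ha] del: index_mult_mat)
    also have "\<dots> = (\<Sum>j<nt. \<Sum>k<mrank H. cnj (w k i) * (B $$ (a, j) * cnj (c k j)))"
      using ai by (simp add: wc sum_distrib_left mult_ac)
    also have "\<dots> = (\<Sum>k<mrank H. \<Sum>j<nt. cnj (w k i) * (B $$ (a, j) * cnj (c k j)))" by (rule sum.swap)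
    also have "\<dots> = 0" by (simp add: z flip: sum_distrib_left)
    finally show "(B * mat_adjoint H) $$ (a, i) = 0\<^sub>m nt nr $$ (a, i)" using ai by simp
  qed (use Bc H in auto)
  have "A * mat_adjoint H = cov nt (mrank H) s * mat_adjoint H"
    using Bc Ha BH mult_carrier_mat[OF cov_carrier Ha] unfolding B(3)
    by (simp add: add_mult_distrib_mat[of _ nt nt] left_add_zero_mat[of _ nt nr])
  then have "H * A * mat_adjoint H = H * cov nt (mrank H) s * mat_adjoint H"
    using H Ha psd_matD(1)[OF A]
    by (simp add: assoc_mult_mat[of H nr nt _ nt "mat_adjoint H" nr])
  also have "\<dots> = cov nr (mrank H) (\<lambda>k. H *\<^sub>v s k)" using B(1) by (intro congruence_cov[OF H]) auto
  finally show thesis using that B by blast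
qed

subsection \<open>Rates and SINRs\<close>

lemma gain_cip: "gain r A t = (cmod (cip r (A *\<^sub>v t)))\<^sup>2"
  unfolding gain_def cip_def ..

lemma gain_nonneg [simp]: "0 \<le> gain r A t"
  unfolding gain_def by simp

lemma gain_scaled:
  assumes "A \<in> carrier_mat nr nt" "r \<in> carrier_vec nr" "t \<in> carrier_vec nt" "0 \<le> p"
  shows "gain r A (complex_of_real (sqrt p) \<cdot>\<^sub>v t) = p * gain r A t"
  using assms unfolding gain_cip
  by (simp add: mult_mat_vec[of A nr nt] cip_smult_right[where n = nr] norm_mult power_mult_distrib)

text \<open>Translates interference between its two descriptions: a form of the transmit covariance
  and a sum of stream gains.\<close>

lemma qform_cov_gain:
  assumes H: "H \<in> carrier_mat nr nt" and s: "\<And>k. k < N \<Longrightarrow> s k \<in> carrier_vec nt" and r: "r \<in> carrier_vec nr"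
  shows "qform (cov nt N s) (mat_adjoint H *\<^sub>v r) = (\<Sum>k<N. gain r H (s k))"
proof -
  have "mat_adjoint H *\<^sub>v r \<in> carrier_vec nt" by (rule mult_mat_vec_carrier[OF adjoint_carrier[OF H] r])
  then have "qform (cov nt N s) (mat_adjoint H *\<^sub>v r) = (\<Sum>k<N. (cmod (cip (mat_adjoint H *\<^sub>v r) (s k)))\<^sup>2)"
    using s by (intro qform_cov) auto
  also have "\<dots> = (\<Sum>k<N. gain r H (s k))"
    unfolding gain_cip using s by (intro sum.cong) (auto simp: cip_adjoint[OF H r])
  finally show ?thesis .
qed

lemma mtrace_add: "A \<in> carrier_mat n n \<Longrightarrow> B \<in> carrier_mat n n \<Longrightarrow> mtrace (A + B) = mtrace A + mtrace B"
  unfolding mtrace_def by (simp add: sum.distrib)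

text \<open>Diagonal entries are form values at the standard basis vectors.\<close>

lemma mtrace_psd:
  assumes "psd_mat n A"
  shows "0 \<le> Re (mtrace A)"
proof -
  note a = psd_matD[OF assms]
  have "Re (A $$ (i, i)) = qform A (unit_vec n i)" if "i < n" for i
  proof -
    have "cip (unit_vec n i) (A *\<^sub>v unit_vec n i) = (A *\<^sub>v unit_vec n i) $ i"
      using that a(1) by (subst cip_sum[of _ n]) (auto simp: unit_vec_def if_distrib[of cnj] sum.delta if_distrib[of "\<lambda>x. x * _"]
        simp del: index_mult_mat_vec cong: if_cong)
    also have "\<dots> = A $$ (i, i)" using that a(1) by simp
    finally show ?thesis unfolding qform_def by simp
  qed
  then show ?thesis
    unfolding mtrace_def using a(1) by (auto intro!: sum_nonneg simp: a(3))
qed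

lemma mtrace_cov:
  assumes "\<And>k. k < N \<Longrightarrow> s k \<in> carrier_vec n"
  shows "Re (mtrace (cov n N s)) = (\<Sum>k<N. Re (cip (s k) (s k)))"
proof -
  have "Re (mtrace (cov n N s)) = (\<Sum>i<n. \<Sum>k<N. (cmod (s k $ i))\<^sup>2)"
    unfolding mtrace_def by (simp add: cov_index complex_norm_square[symmetric] del: of_real_power)
  also have "\<dots> = (\<Sum>k<N. \<Sum>i<n. (cmod (s k $ i))\<^sup>2)" by (rule sum.swap)
  also have "\<dots> = (\<Sum>k<N. Re (cip (s k) (s k)))" using assms by (intro sum.cong) (auto simp: cip_self[where n = n])
  finally show ?thesis .
qed

lemma qform_zero:
  assumes "v \<in> carrier_vec n"
  shows "qform (0\<^sub>m n n) v = 0"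
proof -
  have "0\<^sub>m n n *\<^sub>v v = 0\<^sub>v n" using assms by (intro eq_vecI) auto
  then show ?thesis using assms by (simp add: qform_def cip_sum[of _ n])
qed

lemma psd_zero: "psd_mat n (0\<^sub>m n n)"
  by (rule psd_matI) (auto simp: qform_zero intro!: eq_matI)

lemma psd_mat_sum:
  assumes "\<And>k. k < K \<Longrightarrow> psd_mat n (f k)"
  shows "psd_mat n (mat_sum n n f K)"
    "v \<in> carrier_vec n \<Longrightarrow> qform (mat_sum n n f K) v = (\<Sum>k<K. qform (f k) v)"
proof -
  have "psd_mat n (mat_sum n n f K) \<and> (v \<in> carrier_vec n \<longrightarrow> qform (mat_sum n n f K) v = (\<Sum>k<K. qform (f k) v))"
    using assms
  proof (induction K)
    case 0
    then show ?case using psd_zero by (auto simp: qform_zero)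
  next
    case (Suc K)
    then have 1: "psd_mat n (mat_sum n n f K)" "psd_mat n (f K)"
       "v \<in> carrier_vec n \<Longrightarrow> qform (mat_sum n n f K) v = (\<Sum>k<K. qform (f k) v)" by auto
    note a = psd_matD[OF 1(1)] and b = psd_matD[OF 1(2)]
    have "psd_mat n (mat_sum n n f K + f K)"
      using a b by (intro psd_matI) (auto simp: adjoint_add[of _ n n] qform_add[of _ n])
    then show ?case using 1(3) a(1) b(1) by (auto simp: qform_add[of _ n])
  qed
  then show "psd_mat n (mat_sum n n f K)"
    "v \<in> carrier_vec n \<Longrightarrow> qform (mat_sum n n f K) v = (\<Sum>k<K. qform (f k) v)" by auto
qed

section \<open>The network, and the passage between strategies and covariances\<close>

locale bmac =
  fixes L :: nat and NT NR :: "nat \<Rightarrow> nat"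
    and H :: "nat \<Rightarrow> nat \<Rightarrow> complex mat" and Phi :: "nat \<Rightarrow> nat \<Rightarrow> bool"
  assumes L: "1 \<le> L"
    and H: "\<And>l k. l < L \<Longrightarrow> k < L \<Longrightarrow> H l k \<in> carrier_mat (NR l) (NT k)"
    and Phi: "\<And>l. l < L \<Longrightarrow> \<not> Phi l l"
    and H_nonzero: "\<And>l. l < L \<Longrightarrow> H l l \<noteq> 0\<^sub>m (NR l) (NT l)"
begin

abbreviation M :: "nat \<Rightarrow> nat" where "M l \<equiv> mrank (H l l)"

text \<open>A nonzero direct channel gives every link a stream, which makes the rate per stream and
  the minimum over streams meaningful.\<close>

lemma M_pos: "l < L \<Longrightarrow> 0 < M l"
  using mrank_pos[OF H H_nonzero] by simp

lemma dim_pos: "l < L \<Longrightarrow> 0 < NT l" "l < L \<Longrightarrow> 0 < NR l"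
proof -
  assume l: "l < L"
  show "0 < NT l" "0 < NR l"
    using H[OF l l] H_nonzero[OF l] by (auto intro!: gr0I eq_matI)
qed

lemma Omega_form:
  assumes S: "\<And>k. k < L \<Longrightarrow> psd_mat (NT k) (\<Sigma> k)" and l: "l < L"
  shows "pd_mat (NR l) (Omega L NR H Phi \<Sigma> l)"
    and "r \<in> carrier_vec (NR l) \<Longrightarrow> qform (Omega L NR H Phi \<Sigma> l) r =
      Re (cip r r) + (\<Sum>k<L. if Phi l k then qform (\<Sigma> k) (mat_adjoint (H l k) *\<^sub>v r) else 0)"
proof -
  let ?f = "\<lambda>k. if Phi l k then H l k * \<Sigma> k * mat_adjoint (H l k) else 0\<^sub>m (NR l) (NR l)"
  have f: "psd_mat (NR l) (?f k)" if "k < L" for k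
    using psd_congruence[OF H[OF l that] S[OF that]] psd_zero by auto
  note ms = psd_mat_sum[of L "NR l" ?f, OF f]
  show "pd_mat (NR l) (Omega L NR H Phi \<Sigma> l)"
    unfolding Omega_def by (rule pd_add_psd[OF pd_one ms(1)])
  assume r: "r \<in> carrier_vec (NR l)"
  have z: "qform (0\<^sub>m (NR l) (NR l)) r = 0" using r by (rule qform_zero)
  have "qform (Omega L NR H Phi \<Sigma> l) r = Re (cip r r) + (\<Sum>k<L. qform (?f k) r)"
    unfolding Omega_def using r psd_matD(1)[OF ms(1)]
    by (subst qform_add[of _ "NR l"]) (auto simp: ms(2)[OF _ r] qform_def[of "1\<^sub>m _"])
  also have "(\<Sum>k<L. qform (?f k) r) = (\<Sum>k<L. if Phi l k then qform (\<Sigma> k) (mat_adjoint (H l k) *\<^sub>v r) else 0)"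
    using z qform_congruence[OF H[OF l] psd_matD(1)[OF S] r] by (intro sum.cong) auto
  finally show "qform (Omega L NR H Phi \<Sigma> l) r =
      Re (cip r r) + (\<Sum>k<L. if Phi l k then qform (\<Sigma> k) (mat_adjoint (H l k) *\<^sub>v r) else 0)" .
qed

text \<open>Multiplying \<open>1 + A \<Omega>\<^sup>-\<^sup>1\<close> by \<open>\<Omega>\<close> on
  the right gives \<open>\<Omega> + A\<close>. Stating the determinant ratio as a product with a
  real \<open>\<rho>\<close> avoids division and shows that \<open>Re\<close> in \<open>rate\<close>
  discards nothing.\<close>

lemma rate_eq_ln:
  assumes S: "\<And>k. k < L \<Longrightarrow> psd_mat (NT k) (\<Sigma> k)" and l: "l < L"
    and \<rho>: "det (Omega L NR H Phi \<Sigma> l + H l l * \<Sigma> l * mat_adjoint (H l l)) =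
      complex_of_real \<rho> * det (Omega L NR H Phi \<Sigma> l)"
  shows "rate L NR H Phi \<Sigma> l = ln \<rho>"
proof -
  let ?O = "Omega L NR H Phi \<Sigma> l" and ?A = "H l l * \<Sigma> l * mat_adjoint (H l l)" and ?n = "NR l"
  have O: "pd_mat ?n ?O" by (rule Omega_form[OF S l])
  note Oc = pd_matD(1)[OF O] and Oi = pd_inverse[OF O]
  have A: "?A \<in> carrier_mat ?n ?n" by (rule psd_matD(1)[OF psd_congruence[OF H[OF l l] S[OF l]]])
  have AO: "?A * minv ?O \<in> carrier_mat ?n ?n" by (rule mult_carrier_mat[OF A Oi(1)])
  have e: "(1\<^sub>m ?n + ?A * minv ?O) * ?O = ?O + ?A"
  proof -
    have "?A * minv ?O * ?O = ?A"
      unfolding assoc_mult_mat[OF A Oi(1) Oc] Oi(3) using A by (rule right_mult_one_mat)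
    then show ?thesis using AO Oc by (simp add: add_mult_distrib_mat[of _ ?n ?n])
  qed
  have c: "1\<^sub>m ?n + ?A * minv ?O \<in> carrier_mat ?n ?n" using AO by simp
  have "det (1\<^sub>m ?n + ?A * minv ?O) * det ?O = of_real \<rho> * det ?O"
    unfolding det_mult[OF c Oc, symmetric] e by (rule \<rho>)
  then have "det (1\<^sub>m ?n + ?A * minv ?O) = of_real \<rho>"
    using pd_det[OF O] by simp
  then show ?thesis unfolding rate_def by simp
qed

text \<open>Separates other links from the later streams of the same link. As \<open>Phi l l\<close>
  is false, the own link enters only through the second part.\<close>

lemma interference_eq:
  assumes l: "l < L"
  shows "1 + (\<Sum>k<L. \<Sum>n<M k. p k n * Psi H Phi T R l m k n) =
     1 + (\<Sum>k<L. if Phi l k then \<Sum>n<M k. p k n * gain (R l m) (H l k) (T k n) else 0)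
       + (\<Sum>n\<in>{m<..<M l}. p l n * gain (R l m) (H l l) (T l n))"
proof -
  let ?x = "\<Sum>n\<in>{m<..<M l}. p l n * gain (R l m) (H l l) (T l n)"
  have own: "(\<Sum>n<M l. p l n * Psi H Phi T R l m l n) = ?x"
    unfolding Psi_def by (intro sum.mono_neutral_cong_right) auto
  have "(\<Sum>n<M k. p k n * Psi H Phi T R l m k n) =
     (if Phi l k then \<Sum>n<M k. p k n * gain (R l m) (H l k) (T k n) else 0) + (if k = l then ?x else 0)"
    if "k < L" for k
    using Phi[OF l] own by (cases "k = l") (auto simp: Psi_def)
  then have "(\<Sum>k<L. \<Sum>n<M k. p k n * Psi H Phi T R l m k n) =
     (\<Sum>k<L. (if Phi l k then \<Sum>n<M k. p k n * gain (R l m) (H l k) (T k n) else 0) + (if k = l then ?x else 0))"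
    by (intro sum.cong) auto
  then show ?thesis using l by (simp add: sum.distrib)
qed

lemma interference_ge_1:
  assumes l: "l < L" and p: "\<And>k n. k < L \<Longrightarrow> n < M k \<Longrightarrow> 0 \<le> p k n"
  shows "1 \<le> 1 + (\<Sum>k<L. \<Sum>n<M k. p k n * Psi H Phi T R l m k n)"
  using p by (auto intro!: sum_nonneg mult_nonneg_nonneg simp: Psi_def)

text \<open>The covariance is fixed before \<open>l\<close> and \<open>g\<close>, so that one
  feasible point serves all links at once, each with its own SINR bound.\<close>

lemma FOP_of_EFOP:
  assumes feas: "EFOP_feasible L NT NR M PT T R p"
  obtains \<Sigma> where "FOP_feasible L NT PT \<Sigma>"
    "\<And>l g. l < L \<Longrightarrow> 0 \<le> g \<Longrightarrow> (\<And>m. m < M l \<Longrightarrow> g \<le> SINR L M H Phi T R p l m) \<Longrightarrow>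
       real (M l) * ln (1 + g) \<le> rate L NR H Phi \<Sigma> l"
proof -
  have T: "T l m \<in> carrier_vec (NT l)" "cip (T l m) (T l m) = 1"
    and R: "R l m \<in> carrier_vec (NR l)" "cip (R l m) (R l m) = 1" and p: "0 \<le> p l m"
    if "l < L" "m < M l" for l m
    using feas that unfolding EFOP_feasible_def unit_cvec_iff by auto
  define s where "s l m = complex_of_real (sqrt (p l m)) \<cdot>\<^sub>v T l m" for l m
  have s: "s l m \<in> carrier_vec (NT l)" if "l < L" "m < M l" for l m using T that unfolding s_def by auto
  have gs: "gain r (H j l) (s l m) = p l m * gain r (H j l) (T l m)"
    if "l < L" "m < M l" "j < L" "r \<in> carrier_vec (NR j)" for r j l m
    unfolding s_def by (rule gain_scaled[OF H[OF that(3,1)] that(4) T(1)[OF that(1,2)] p[OF that(1,2)]])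
  define \<Sigma> where "\<Sigma> l = cov (NT l) (M l) (s l)" for l
  have S: "psd_mat (NT l) (\<Sigma> l)" if "l < L" for l unfolding \<Sigma>_def using s[OF that] by (rule psd_cov)
  have "Re (cip (s l m) (s l m)) = p l m" if "l < L" "m < M l" for l m
  proof -
    have "complex_of_real (sqrt (p l m)) * complex_of_real (sqrt (p l m)) = of_real (p l m)"
      using p[OF that] by (simp flip: of_real_mult)
    then show ?thesis
      using T[OF that] unfolding s_def by (simp add: cip_smult_left[where n = "NT l"] cip_smult_right[where n = "NT l"])
  qed
  then have tr: "Re (mtrace (\<Sigma> l)) = (\<Sum>m<M l. \<bar>p l m\<bar>)" if "l < L" for l
    unfolding \<Sigma>_def using that s p by (subst mtrace_cov) (auto intro!: sum.cong)
  have FOP: "FOP_feasible L NT PT \<Sigma>"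
    unfolding FOP_feasible_def using S tr feas by (auto simp: EFOP_feasible_def)
  have "real (M l) * ln (1 + g) \<le> rate L NR H Phi \<Sigma> l"
    if l: "l < L" and g: "0 \<le> g" and sinr: "\<And>m. m < M l \<Longrightarrow> g \<le> SINR L M H Phi T R p l m" for l g
  proof -
    let ?K = "Omega L NR H Phi \<Sigma> l"
    have "\<exists>\<rho>. (1 + g) ^ M l \<le> \<rho> \<and> det (?K + cov (NR l) (M l) (\<lambda>m. H l l *\<^sub>v s l m)) = of_real \<rho> * det ?K"
    proof (rule sic_det_lower_bound[OF g])
      show "pd_mat (NR l) ?K" by (rule Omega_form[OF S l])
      show "H l l *\<^sub>v s l k \<in> carrier_vec (NR l)" if "k < M l" for k
        using s[OF l that] H[OF l l] by auto
      fix m assume m: "m < M l"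
      note Rm = R[OF l m]
      have "g * (1 + (\<Sum>k<L. \<Sum>n<M k. p k n * Psi H Phi T R l m k n)) \<le> p l m * gain (R l m) (H l l) (T l m)"
        using sinr[OF m] interference_ge_1[OF l, of p T R m] p unfolding SINR_def by (simp add: field_simps)
      \<comment> \<open>The unit norm of the receiver turns the noise term of the form into the 1 of
        the SINR denominator.\<close>
      moreover have "1 + (\<Sum>k<L. \<Sum>n<M k. p k n * Psi H Phi T R l m k n) =
        qform ?K (R l m) + (\<Sum>k\<in>{m<..<M l}. gain (R l m) (H l l) (s l k))"
      proof -
        have "(\<Sum>k<L. if Phi l k then \<Sum>n<M k. p k n * gain (R l m) (H l k) (T k n) else 0) =
           (\<Sum>k<L. if Phi l k then qform (\<Sigma> k) (mat_adjoint (H l k) *\<^sub>v R l m) else 0)"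
          unfolding \<Sigma>_def using l Rm s
          by (intro sum.cong) (auto simp: gs qform_cov_gain[OF H[OF l]])
        moreover have "(\<Sum>n\<in>{m<..<M l}. p l n * gain (R l m) (H l l) (T l n)) = (\<Sum>k\<in>{m<..<M l}. gain (R l m) (H l l) (s l k))"
          using l Rm by (intro sum.cong) (auto simp: gs)
        ultimately show ?thesis
          unfolding interference_eq[OF l] using Omega_form(2)[OF S l Rm(1)] Rm(2) by simp
      qed
      ultimately have "g * (qform ?K (R l m) + (\<Sum>k\<in>{m<..<M l}. gain (R l m) (H l l) (s l k))) \<le> gain (R l m) (H l l) (s l m)"
        using gs[OF l m l Rm(1)] by simp
      moreover have "R l m \<noteq> 0\<^sub>v (NR l)" using Rm(2) by (auto simp: cip_sum[of _ "NR l"])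
      ultimately show "\<exists>r\<in>carrier_vec (NR l). r \<noteq> 0\<^sub>v (NR l) \<and>
         g * (qform ?K r + (\<Sum>k\<in>{m<..<M l}. (cmod (cip r (H l l *\<^sub>v s l k)))\<^sup>2)) \<le> (cmod (cip r (H l l *\<^sub>v s l m)))\<^sup>2"
        unfolding gain_cip using Rm(1) by blast
    qed
    then obtain \<rho> where \<rho>: "(1 + g) ^ M l \<le> \<rho>"
      "det (?K + cov (NR l) (M l) (\<lambda>m. H l l *\<^sub>v s l m)) = of_real \<rho> * det ?K" by auto
    have "H l l * \<Sigma> l * mat_adjoint (H l l) = cov (NR l) (M l) (\<lambda>m. H l l *\<^sub>v s l m)"
      unfolding \<Sigma>_def by (rule congruence_cov[OF H[OF l l] s[OF l]])
    then have "rate L NR H Phi \<Sigma> l = ln \<rho>"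
      using \<rho>(2) by (intro rate_eq_ln[OF S l]) auto
    moreover have "real (M l) * ln (1 + g) = ln ((1 + g) ^ M l)" using g by (simp add: ln_realpow)
    moreover have "ln ((1 + g) ^ M l) \<le> ln \<rho>"
    proof -
      have "0 < (1 + g) ^ M l" using g by (intro zero_less_power) simp
      then show ?thesis using \<rho>(1) ln_le_cancel_iff[of "(1 + g) ^ M l" \<rho>] by linarith
    qed
    ultimately show ?thesis by simp
  qed
  with FOP show thesis using that by blast
qed

text \<open>The noise covariance is the one caused by the original \<open>\<Sigma>\<close>. Since the new streams cause less
  interference, the actual SINRs can only be larger, and no monotonicity of the rate is needed.\<close>

lemma link_streams:
  assumes S: "\<And>k. k < L \<Longrightarrow> psd_mat (NT k) (\<Sigma> k)" and l: "l < L" and pos: "0 < rate L NR H Phi \<Sigma> l"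
  shows "\<exists>s R. (\<forall>m<M l. s m \<in> carrier_vec (NT l) \<and> unit_cvec (NR l) (R m)) \<and>
    (\<forall>w \<in> carrier_vec (NT l). qform (cov (NT l) (M l) s) w \<le> qform (\<Sigma> l) w) \<and>
    (\<Sum>m<M l. Re (cip (s m) (s m))) \<le> Re (mtrace (\<Sigma> l)) \<and>
    (\<forall>m<M l. (exp (rate L NR H Phi \<Sigma> l / real (M l)) - 1) *
        (qform (Omega L NR H Phi \<Sigma> l) (R m) + (\<Sum>k\<in>{m<..<M l}. gain (R m) (H l l) (s k)))
        \<le> gain (R m) (H l l) (s m))"
proof -
  let ?K = "Omega L NR H Phi \<Sigma> l" and ?M = "M l" and ?H = "H l l"
  let ?d = "exp (rate L NR H Phi \<Sigma> l / real ?M)"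
  have K: "pd_mat (NR l) ?K" by (rule Omega_form[OF S l])
  obtain s B where B: "\<And>k. k < ?M \<Longrightarrow> s k \<in> carrier_vec (NT l)" "psd_mat (NT l) B" "\<Sigma> l = B + cov (NT l) ?M s"
    "?H * \<Sigma> l * mat_adjoint ?H = cov (NR l) ?M (\<lambda>k. ?H *\<^sub>v s k)"
    using rank_reduced_covariance[OF H[OF l l] S[OF l]] by blast
  txt \<open>The instance \<open>g = 0\<close> only serves to see that the ratio of determinants is real and at least 1.\<close>
  have "\<exists>\<rho>. (1 + 0) ^ ?M \<le> \<rho> \<and> det (?K + cov (NR l) ?M (\<lambda>m. ?H *\<^sub>v s m)) = of_real \<rho> * det ?K"
  proof (rule sic_det_lower_bound[OF _ K])
    show "?H *\<^sub>v s k \<in> carrier_vec (NR l)" if "k < ?M" for k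
      using B(1)[OF that] H[OF l l] by auto
    show "\<exists>r\<in>carrier_vec (NR l). r \<noteq> 0\<^sub>v (NR l) \<and>
       0 * (qform ?K r + (\<Sum>k\<in>{m<..<?M}. (cmod (cip r (?H *\<^sub>v s k)))\<^sup>2)) \<le> (cmod (cip r (?H *\<^sub>v s m)))\<^sup>2" for m
      using dim_pos(2)[OF l] by (intro bexI[of _ "unit_vec (NR l) 0"]) auto
  qed auto
  then obtain \<rho> where \<rho>: "1 \<le> \<rho>" "det (?K + cov (NR l) ?M (\<lambda>m. ?H *\<^sub>v s m)) = of_real \<rho> * det ?K" by auto
  have rate: "rate L NR H Phi \<Sigma> l = ln \<rho>"
    using \<rho>(2) B(4) by (intro rate_eq_ln[OF S l]) auto
  \<comment> \<open>The rate is shared equally by the streams, each contributing the determinant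
    factor \<open>?d\<close>.\<close>
  have "?d ^ ?M = exp (rate L NR H Phi \<Sigma> l)"
    using M_pos[OF l] by (simp flip: exp_of_nat_mult)
  then have d: "?d ^ ?M = \<rho>" using rate \<rho>(1) by simp
  have d1: "1 < ?d" using pos M_pos[OF l] by simp
  obtain s' R where s': "\<And>k. k < ?M \<Longrightarrow> s' k \<in> carrier_vec (NT l)" "\<And>k. k < ?M \<Longrightarrow> unit_cvec (NR l) (R k)"
     "cov (NT l) ?M s' = cov (NT l) ?M s"
     "\<And>m. m < ?M \<Longrightarrow> (?d - 1) * (qform ?K (R m) + (\<Sum>k\<in>{m<..<?M}. gain (R m) ?H (s' k))) \<le> gain (R m) ?H (s' m)"
    using equal_sinr_streams[OF d1 H[OF l l] K, of ?M s] B(1) \<rho>(2) d unfolding gain_cip by auto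
  note Bc = psd_matD[OF B(2)]
  have "qform (cov (NT l) ?M s') w \<le> qform (\<Sigma> l) w" if "w \<in> carrier_vec (NT l)" for w
    unfolding s'(3) B(3) using Bc that by (simp add: qform_add[of _ "NT l"])
  moreover have "(\<Sum>m<?M. Re (cip (s' m) (s' m))) \<le> Re (mtrace (\<Sigma> l))"
    using mtrace_cov[of ?M s' "NT l"] s'(1,3) B(3) Bc(1) mtrace_psd[OF B(2)] by (simp add: mtrace_add[of _ "NT l"])
  ultimately show ?thesis using s' by blast
qed

text \<open>The links are treated independently by \<open>link_streams\<close> and then assembled.
  Positive rates force every stream vector to be nonzero, so each splits into a direction and a
  power.\<close>

lemma EFOP_of_FOP:
  assumes feas: "FOP_feasible L NT PT \<Sigma>" and pos: "\<And>l. l < L \<Longrightarrow> 0 < rate L NR H Phi \<Sigma> l"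
  obtains T R p where "EFOP_feasible L NT NR M PT T R p"
    "\<And>l m. l < L \<Longrightarrow> m < M l \<Longrightarrow> exp (rate L NR H Phi \<Sigma> l / real (M l)) - 1 \<le> SINR L M H Phi T R p l m"
proof -
  have S: "psd_mat (NT l) (\<Sigma> l)" if "l < L" for l using feas that unfolding FOP_feasible_def by auto
  let ?K = "\<lambda>l. Omega L NR H Phi \<Sigma> l" and ?g = "\<lambda>l. exp (rate L NR H Phi \<Sigma> l / real (M l)) - 1"
  \<comment> \<open>Packs the conditions on one link so that streams and receivers for all links can
    be chosen together.\<close>
  define Q where "Q l s R \<longleftrightarrow> (\<forall>m<M l. s m \<in> carrier_vec (NT l) \<and> unit_cvec (NR l) (R m)) \<and>
    (\<forall>w \<in> carrier_vec (NT l). qform (cov (NT l) (M l) s) w \<le> qform (\<Sigma> l) w) \<and>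
    (\<Sum>m<M l. Re (cip (s m) (s m))) \<le> Re (mtrace (\<Sigma> l)) \<and>
    (\<forall>m<M l. ?g l * (qform (?K l) (R m) + (\<Sum>k\<in>{m<..<M l}. gain (R m) (H l l) (s k)))
        \<le> gain (R m) (H l l) (s m))" for l s R
  have "\<exists>s R. Q l s R" if "l < L" for l
    unfolding Q_def by (rule link_streams[OF S that pos[OF that]])
  then obtain s R where Q: "\<And>l. l < L \<Longrightarrow> Q l (s l) (R l)" by metis
  have s: "s l m \<in> carrier_vec (NT l)" and R: "unit_cvec (NR l) (R l m)"
    and key: "?g l * (qform (?K l) (R l m) + (\<Sum>k\<in>{m<..<M l}. gain (R l m) (H l l) (s l k))) \<le> gain (R l m) (H l l) (s l m)"
    if "l < L" "m < M l" for l m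
    using Q[OF that(1)] that(2) unfolding Q_def by blast+
  have dom: "l < L \<Longrightarrow> w \<in> carrier_vec (NT l) \<Longrightarrow> qform (cov (NT l) (M l) (s l)) w \<le> qform (\<Sigma> l) w"
    and tr: "l < L \<Longrightarrow> (\<Sum>m<M l. Re (cip (s l m) (s l m))) \<le> Re (mtrace (\<Sigma> l))" for l w
    using Q[of l] unfolding Q_def by blast+
  have g: "0 < ?g l" if "l < L" for l using pos[OF that] M_pos[OF that] by simp
  have Rc: "R l m \<in> carrier_vec (NR l)" "cip (R l m) (R l m) = 1" if "l < L" "m < M l" for l m
    using R[OF that] unfolding unit_cvec_iff by auto
  \<comment> \<open>A zero vector has zero gain, contradicting the positive SINR target against
    positive definite noise.\<close>
  have s0: "s l m \<noteq> 0\<^sub>v (NT l)" if lm: "l < L" "m < M l" for l m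
  proof
    assume z: "s l m = 0\<^sub>v (NT l)"
    have "0 < qform (?K l) (R l m)"
      using Rc[OF lm] by (intro pd_matD(3)[OF Omega_form(1)[OF S lm(1)]]) (auto simp: cip_sum[of _ "NR l"])
    moreover have "0 \<le> (\<Sum>k\<in>{m<..<M l}. gain (R l m) (H l l) (s l k))" by (intro sum_nonneg) auto
    ultimately have "0 < gain (R l m) (H l l) (s l m)"
      using key[OF lm] g[OF lm(1)] by (smt (verit) mult_pos_pos)
    then show False unfolding gain_cip z using Rc[OF lm] H[OF lm(1) lm(1)]
      by (simp add: cip_def scalar_prod_def)
  qed
  define p where "p l m = Re (cip (s l m) (s l m))" for l m
  define T where "T l m = complex_of_real (1 / sqrt (p l m)) \<cdot>\<^sub>v s l m" for l m
  have p: "0 < p l m" and T: "unit_cvec (NT l) (T l m)" and sT: "s l m = complex_of_real (sqrt (p l m)) \<cdot>\<^sub>v T l m"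
    if "l < L" "m < M l" for l m
  proof -
    show p: "0 < p l m" unfolding p_def by (rule cip_self_pos[OF s[OF that] s0[OF that]])
    show "unit_cvec (NT l) (T l m)" unfolding T_def p_def by (rule normalize_unit[OF s[OF that] s0[OF that]])
    show "s l m = complex_of_real (sqrt (p l m)) \<cdot>\<^sub>v T l m" unfolding T_def using p by (simp add: smult_smult_assoc)
  qed
  have gs: "gain r (H j l) (s l m) = p l m * gain r (H j l) (T l m)"
    if "l < L" "m < M l" "j < L" "r \<in> carrier_vec (NR j)" for r j l m
    unfolding sT[OF that(1,2)] using T[OF that(1,2)] p[OF that(1,2)] that
    by (intro gain_scaled[OF H]) (auto simp: unit_cvec_def)
  have feas': "EFOP_feasible L NT NR M PT T R p"
  proof -
    have "(\<Sum>l<L. \<Sum>m<M l. \<bar>p l m\<bar>) = (\<Sum>l<L. \<Sum>m<M l. Re (cip (s l m) (s l m)))"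
      using p by (intro sum.cong) (auto simp: p_def abs_of_pos)
    also have "\<dots> \<le> (\<Sum>l<L. Re (mtrace (\<Sigma> l)))" using tr by (intro sum_mono) auto
    also have "\<dots> \<le> PT" using feas unfolding FOP_feasible_def by auto
    finally show ?thesis unfolding EFOP_feasible_def using T R p by (auto intro: less_imp_le)
  qed
  have "?g l \<le> SINR L M H Phi T R p l m" if lm: "l < L" "m < M l" for l m
  proof -
    note l = lm(1)
    let ?D = "1 + (\<Sum>k<L. \<Sum>n<M k. p k n * Psi H Phi T R l m k n)"
    \<comment> \<open>Each interfering link now transmits a covariance dominated by its original
      one.\<close>
    have "(\<Sum>k<L. if Phi l k then \<Sum>n<M k. p k n * gain (R l m) (H l k) (T k n) else 0) \<le>
       (\<Sum>k<L. if Phi l k then qform (\<Sigma> k) (mat_adjoint (H l k) *\<^sub>v R l m) else 0)"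
    proof (rule sum_mono)
      fix k assume "k \<in> {..<L}"
      then have k: "k < L" by simp
      have "(\<Sum>n<M k. p k n * gain (R l m) (H l k) (T k n)) = qform (cov (NT k) (M k) (s k)) (mat_adjoint (H l k) *\<^sub>v R l m)"
        using Rc(1)[OF lm] s k by (subst qform_cov_gain[OF H[OF l k]]) (auto simp: gs[OF k _ l])
      also have "\<dots> \<le> qform (\<Sigma> k) (mat_adjoint (H l k) *\<^sub>v R l m)"
        by (rule dom[OF k mult_mat_vec_carrier[OF adjoint_carrier[OF H[OF l k]] Rc(1)[OF lm]]])
      finally show "(if Phi l k then \<Sum>n<M k. p k n * gain (R l m) (H l k) (T k n) else 0) \<le>
         (if Phi l k then qform (\<Sigma> k) (mat_adjoint (H l k) *\<^sub>v R l m) else 0)" by simp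
    qed
    moreover have "(\<Sum>n\<in>{m<..<M l}. p l n * gain (R l m) (H l l) (T l n)) = (\<Sum>k\<in>{m<..<M l}. gain (R l m) (H l l) (s l k))"
      using l Rc[OF lm] by (intro sum.cong) (auto simp: gs)
    ultimately have "?D \<le> qform (?K l) (R l m) + (\<Sum>k\<in>{m<..<M l}. gain (R l m) (H l l) (s l k))"
      unfolding interference_eq[OF l] using Omega_form(2)[OF S l Rc(1)[OF lm]] Rc(2)[OF lm] by simp
    from order_trans[OF mult_left_mono[OF this less_imp_le[OF g[OF l]]] key[OF lm]]
    have "?g l * ?D \<le> p l m * gain (R l m) (H l l) (T l m)"
      unfolding gs[OF lm l Rc(1)[OF lm]] .
    moreover have "1 \<le> ?D" using p by (intro interference_ge_1[OF l]) (auto intro: less_imp_le)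
    ultimately show ?thesis unfolding SINR_def by (simp add: pos_le_divide_eq)
  qed
  then show thesis using that feas' by blast
qed

end

subsection \<open>Boundedness of the two problems\<close>

text \<open>Entries of a unit vector have modulus at most 1. So crude a bound suffices: it only
  serves to make the real \<open>Sup\<close> of each problem a genuine supremum.\<close>

lemma gain_bounded:
  assumes A: "A \<in> carrier_mat nr nt" and r: "unit_cvec nr r" and t: "unit_cvec nt t"
  shows "gain r A t \<le> (\<Sum>i<nr. \<Sum>j<nt. cmod (A $$ (i, j)))\<^sup>2"
proof -
  have entry: "cmod (v $ i) \<le> 1" if "unit_cvec n v" "i < n" for n v i
  proof -
    have "(cmod (v $ i))\<^sup>2 \<le> (\<Sum>i<n. (cmod (v $ i))\<^sup>2)"
      by (rule member_le_sum) (use that in auto)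
    then show ?thesis using that(1) by (simp add: unit_cvec_def abs_square_le_1)
  qed
  have c: "r \<in> carrier_vec nr" "t \<in> carrier_vec nt" using r t unfolding unit_cvec_def by auto
  have "cip r (A *\<^sub>v t) = (\<Sum>i<nr. \<Sum>j<nt. cnj (r $ i) * A $$ (i, j) * t $ j)"
    using A c by (subst cip_sum[of _ nr]) (auto simp: mult_mat_vec_index_sum[OF A c(2)] sum_distrib_left mult.assoc
        simp del: index_mult_mat_vec)
  also have "cmod \<dots> \<le> (\<Sum>i<nr. \<Sum>j<nt. cmod (cnj (r $ i) * A $$ (i, j) * t $ j))"
    by (rule order_trans[OF norm_sum sum_mono[OF norm_sum]])
  also have "\<dots> \<le> (\<Sum>i<nr. \<Sum>j<nt. cmod (A $$ (i, j)))"
  proof (intro sum_mono)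
    fix i j assume "i \<in> {..<nr}" "j \<in> {..<nt}"
    then have "cmod (r $ i) * cmod (A $$ (i, j)) * cmod (t $ j) \<le> 1 * cmod (A $$ (i, j)) * 1"
      using entry[OF r] entry[OF t] by (intro mult_mono) auto
    then show "cmod (cnj (r $ i) * A $$ (i, j) * t $ j) \<le> cmod (A $$ (i, j))" by (simp add: norm_mult)
  qed
  finally show ?thesis unfolding gain_cip by (rule power_mono) simp
qed

context bmac
begin

lemma SINR_bounded:
  assumes feas: "EFOP_feasible L NT NR M PT T R p" and l: "l < L" and m: "m < M l"
  shows "SINR L M H Phi T R p l m \<le> PT * (\<Sum>i<NR l. \<Sum>j<NT l. cmod (H l l $$ (i, j)))\<^sup>2"
proof -
  have p: "0 \<le> p k n" if "k < L" "n < M k" for k n using feas that unfolding EFOP_feasible_def by auto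
  have TR: "unit_cvec (NT l) (T l m)" "unit_cvec (NR l) (R l m)"
    using feas l m unfolding EFOP_feasible_def by auto
  have "\<bar>p l m\<bar> \<le> (\<Sum>m<M l. \<bar>p l m\<bar>)" by (rule member_le_sum) (use m in auto)
  also have "\<dots> \<le> (\<Sum>l<L. \<Sum>m<M l. \<bar>p l m\<bar>)" by (rule member_le_sum) (use l in \<open>auto intro: sum_nonneg\<close>)
  also have "\<dots> \<le> PT" using feas unfolding EFOP_feasible_def by auto
  finally have pP: "p l m \<le> PT" "0 \<le> PT" by auto
  have "SINR L M H Phi T R p l m \<le> p l m * gain (R l m) (H l l) (T l m)"
  proof -
    have "1 \<le> 1 + (\<Sum>k<L. \<Sum>n<M k. p k n * Psi H Phi T R l m k n)"
      by (rule interference_ge_1[OF l]) (rule p)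
    from this mult_left_mono[OF this, of "p l m * gain (R l m) (H l l) (T l m)"] show ?thesis
      unfolding SINR_def using p[OF l m] by (subst pos_divide_le_eq) auto
  qed
  also have "\<dots> \<le> PT * (\<Sum>i<NR l. \<Sum>j<NT l. cmod (H l l $$ (i, j)))\<^sup>2"
    using gain_bounded[OF H[OF l l] TR(2,1)] pP p[OF l m] by (intro mult_mono) auto
  finally show ?thesis .
qed

lemma FOP_obj_ge_iff:
  assumes "\<And>l. l < L \<Longrightarrow> 0 < I0 l"
  shows "y \<le> FOP_obj L NR H Phi I0 \<Sigma> \<longleftrightarrow> (\<forall>l<L. y * I0 l \<le> rate L NR H Phi \<Sigma> l)"
proof -
  have "{..<L} \<noteq> {}" using L by (auto simp: lessThan_empty_iff)
  then show ?thesis unfolding FOP_obj_def using assms by (subst Min_ge_iff) (auto simp: pos_le_divide_eq)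
qed

lemma EFOP_obj_ge_iff:
  assumes "\<And>l. l < L \<Longrightarrow> 0 < g0 l"
  shows "y \<le> EFOP_obj L M H Phi g0 T R p \<longleftrightarrow> (\<forall>l<L. \<forall>m<M l. y * g0 l \<le> SINR L M H Phi T R p l m)"
proof -
  let ?S = "{SINR L M H Phi T R p l m / g0 l | l m. l < L \<and> m < M l}"
  have S: "?S = (\<lambda>(l, m). SINR L M H Phi T R p l m / g0 l) ` (SIGMA l:{..<L}. {..<M l})" by force
  have "finite ?S" unfolding S by auto
  moreover have "?S \<noteq> {}"
  proof -
    have "(0, 0) \<in> (SIGMA l:{..<L}. {..<M l})" using L M_pos[of 0] by auto
    then show ?thesis unfolding S by blast
  qed
  ultimately have "y \<le> Min ?S \<longleftrightarrow> (\<forall>a\<in>?S. y \<le> a)" by (rule Min_ge_iff)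
  also have "\<dots> \<longleftrightarrow> (\<forall>l<L. \<forall>m<M l. y \<le> SINR L M H Phi T R p l m / g0 l)" unfolding S by auto
  also have "\<dots> \<longleftrightarrow> (\<forall>l<L. \<forall>m<M l. y * g0 l \<le> SINR L M H Phi T R p l m)"
    using assms by (simp add: pos_le_divide_eq)
  finally show ?thesis unfolding EFOP_obj_def .
qed

lemma FOP_feasible_zero: "0 \<le> PT \<Longrightarrow> FOP_feasible L NT PT (\<lambda>l. 0\<^sub>m (NT l) (NT l))"
  unfolding FOP_feasible_def by (auto simp: psd_zero mtrace_def)

text \<open>At zero power any unit directions are feasible; index 0 exists because all antenna
  numbers are positive (\<open>dim_pos\<close>).\<close>

lemma EFOP_feasible_zero:
  "0 \<le> PT \<Longrightarrow> EFOP_feasible L NT NR M PT (\<lambda>l m. unit_vec (NT l) 0) (\<lambda>l m. unit_vec (NR l) 0) (\<lambda>l m. 0)"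
  unfolding EFOP_feasible_def unit_cvec_iff using dim_pos
  by (auto simp: cip_def)

end

section \<open>Comparison of the two suprema\<close>

lemma exp_mult_le: "0 \<le> c \<Longrightarrow> c \<le> 1 \<Longrightarrow> exp (c * x) \<le> 1 + c * (exp x - 1)" for c x :: real
  using convex_onD[OF exp_convex, of c 0 x] by (simp add: algebra_simps)

theorem theorem6:
  fixes L :: nat and NT NR :: "nat \<Rightarrow> nat"
    and H :: "nat \<Rightarrow> nat \<Rightarrow> complex mat" and Phi :: "nat \<Rightarrow> nat \<Rightarrow> bool"
    and I0 :: "nat \<Rightarrow> real" and PT :: real
  assumes "L \<ge> 1"
    and "\<And>l k. l < L \<Longrightarrow> k < L \<Longrightarrow> H l k \<in> carrier_mat (NR l) (NT k)"
    and "\<And>l. l < L \<Longrightarrow> \<not> Phi l l"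
    and "\<And>l. l < L \<Longrightarrow> H l l \<noteq> 0\<^sub>m (NR l) (NT l)"
    and "\<And>l. l < L \<Longrightarrow> I0 l > 0"
    and "PT > 0"
  shows "FOP_value L NT NR H Phi I0 PT \<ge> 1 \<longleftrightarrow>
         EFOP_value L NT NR (\<lambda>l. mrank (H l l)) H Phi
           (\<lambda>l. exp (I0 l / real (mrank (H l l))) - 1) PT \<ge> 1"
proof -
  interpret bmac L NT NR H Phi by unfold_locales (use assms in auto)
  note I0 = assms(5) and PT = assms(6)
  define x where "x l = I0 l / real (M l)" for l
  define g0 where "g0 l = exp (x l) - 1" for l
  have x: "0 < x l" if "l < L" for l unfolding x_def using that I0 M_pos by simp
  have g0: "0 < g0 l" if "l < L" for l unfolding g0_def using x[OF that] by simp
  note FOP_ge = FOP_obj_ge_iff[of I0, OF I0] and EFOP_ge = EFOP_obj_ge_iff[of g0, OF g0]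
  define F where "F = FOP_obj L NR H Phi I0 ` {\<Sigma>. FOP_feasible L NT PT \<Sigma>}"
  define E where "E = (\<lambda>(T, R, p). EFOP_obj L M H Phi g0 T R p) ` {(T, R, p). EFOP_feasible L NT NR M PT T R p}"
  define B where "B = PT * (\<Sum>i<NR 0. \<Sum>j<NT 0. cmod (H 0 0 $$ (i, j)))\<^sup>2"
  have 0: "0 < L" "0 < M 0" using L M_pos[of 0] by auto
  have B: "SINR L M H Phi T R p 0 0 \<le> B" if "EFOP_feasible L NT NR M PT T R p" for T R p
    unfolding B_def by (rule SINR_bounded[OF that 0])
  have "0 \<le> B" unfolding B_def using PT by simp
  have F0: "F \<noteq> {}" unfolding F_def using FOP_feasible_zero[of PT] PT by auto
  have E0: "E \<noteq> {}" unfolding E_def using EFOP_feasible_zero[of PT] PT by fastforce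
  have E_bdd: "bdd_above E"
  proof (rule bdd_aboveI)
    fix e assume "e \<in> E"
    then obtain T R p where e: "EFOP_feasible L NT NR M PT T R p" "e = EFOP_obj L M H Phi g0 T R p"
      unfolding E_def by auto
    have "e * g0 0 \<le> B" using EFOP_ge[of e T R p] e(2) 0 B[OF e(1)] by fastforce
    then show "e \<le> B / g0 0" using g0[OF 0(1)] by (simp add: pos_le_divide_eq)
  qed
  \<comment> \<open>Serves twice: to bound the values of FOP through the SINR bound, and to pass
    from near-optimal covariances to strategies.\<close>
  have streams: "\<exists>T R p. EFOP_feasible L NT NR M PT T R p \<and>
      (\<forall>l<L. \<forall>m<M l. exp (f * x l) - 1 \<le> SINR L M H Phi T R p l m)"
    if f: "f \<in> F" "0 < f" for f
  proof -
    obtain \<Sigma> where S: "FOP_feasible L NT PT \<Sigma>" "f = FOP_obj L NR H Phi I0 \<Sigma>" using f(1) unfolding F_def by auto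
    have r: "f * I0 l \<le> rate L NR H Phi \<Sigma> l" if "l < L" for l using FOP_ge[of f \<Sigma>] S(2) that by simp
    have "0 < rate L NR H Phi \<Sigma> l" if "l < L" for l
      using r[OF that] mult_pos_pos[OF f(2) I0[OF that]] by linarith
    then obtain T R p where e: "EFOP_feasible L NT NR M PT T R p"
      "\<And>l m. l < L \<Longrightarrow> m < M l \<Longrightarrow> exp (rate L NR H Phi \<Sigma> l / real (M l)) - 1 \<le> SINR L M H Phi T R p l m"
      using EFOP_of_FOP[OF S(1)] by blast
    have "exp (f * x l) - 1 \<le> SINR L M H Phi T R p l m" if lm: "l < L" "m < M l" for l m
    proof -
      have "f * x l \<le> rate L NR H Phi \<Sigma> l / real (M l)"
        using divide_right_mono[OF r[OF lm(1)], of "real (M l)"] by (simp add: x_def)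
      then have "exp (f * x l) \<le> exp (rate L NR H Phi \<Sigma> l / real (M l))" by simp
      then show ?thesis using e(2)[OF lm] by linarith
    qed
    then show ?thesis using e(1) by blast
  qed
  have F_bdd: "bdd_above F"
  proof (rule bdd_aboveI)
    fix f assume f: "f \<in> F"
    show "f \<le> B / x 0"
    proof (cases "0 < f")
      case True
      then have "exp (f * x 0) - 1 \<le> B" using streams[OF f True] B 0 by (meson order_trans)
      \<comment> \<open>Since \<open>exp t \<ge> 1 + t\<close>, the SINR bound controls the rates,
        and no determinant has to be estimated.\<close>
      then have "f * x 0 \<le> B" using exp_ge_add_one_self[of "f * x 0"] by linarith
      then show ?thesis using x[OF 0(1)] by (simp add: pos_le_divide_eq)
    next
      case False
      moreover have "0 \<le> B / x 0" using \<open>0 \<le> B\<close> x[OF 0(1)] by simp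
      ultimately show ?thesis by linarith
    qed
  qed
  have "1 \<le> Sup F \<longleftrightarrow> 1 \<le> Sup E"
  proof
    assume F1: "1 \<le> Sup F"
    show "1 \<le> Sup E"
    proof (rule dense_le)
      fix y :: real assume y: "y < 1"
      \<comment> \<open>At \<open>c = 1\<close> the right side is \<open>g0 l\<close>, which exceeds
        \<open>y * g0 l\<close>. By continuity the inequality persists for \<open>c\<close> slightly
        below 1, simultaneously for the finitely many links.\<close>
      have "\<forall>\<^sub>F c in at_left 1. y * g0 l < exp (c * x l) - 1" if "l < L" for l
      proof (rule order_tendstoD(1))
        show "((\<lambda>c. exp (c * x l) - 1) \<longlongrightarrow> exp (1 * x l) - 1) (at_left 1)"
          by (intro tendsto_intros)
        show "y * g0 l < exp (1 * x l) - 1" using g0[OF that] y by (simp add: g0_def)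
      qed
      then have "\<forall>\<^sub>F c in at_left 1. \<forall>l\<in>{..<L}. y * g0 l < exp (c * x l) - 1"
        by (intro eventually_ball_finite) auto
      moreover have "\<forall>\<^sub>F c in at_left (1::real). 0 < c" by (rule order_tendstoD(1)[OF tendsto_ident_at]) simp
      moreover have "\<forall>\<^sub>F c in at_left (1::real). c < 1" by (simp add: eventually_at_filter)
      ultimately have "\<forall>\<^sub>F c in at_left 1. (\<forall>l\<in>{..<L}. y * g0 l < exp (c * x l) - 1) \<and> 0 < c \<and> c < 1"
        by (intro eventually_conj)
      then obtain c where c: "\<And>l. l < L \<Longrightarrow> y * g0 l < exp (c * x l) - 1" "0 < c" "c < 1"
        using eventually_happens'[OF trivial_limit_at_left_real] by fastforce
      obtain f where f: "f \<in> F" "c < f" using less_cSupD[OF F0, of c] F1 c(3) by auto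
      obtain T R p where e: "EFOP_feasible L NT NR M PT T R p"
        "\<And>l m. l < L \<Longrightarrow> m < M l \<Longrightarrow> exp (f * x l) - 1 \<le> SINR L M H Phi T R p l m"
        using streams[OF f(1)] f(2) c(2) by (meson less_trans)
      have "y * g0 l \<le> SINR L M H Phi T R p l m" if lm: "l < L" "m < M l" for l m
      proof -
        have "exp (c * x l) \<le> exp (f * x l)" using f(2) x[OF lm(1)] by simp
        then show ?thesis using c(1)[OF lm(1)] e(2)[OF lm] by linarith
      qed
      then have "y \<le> EFOP_obj L M H Phi g0 T R p" using EFOP_ge by blast
      also have "\<dots> \<le> Sup E" using e(1) by (intro cSup_upper[OF _ E_bdd]) (force simp: E_def)
      finally show "y \<le> Sup E" .
    qed
  next
    assume E1: "1 \<le> Sup E"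
    show "1 \<le> Sup F"
    proof (rule dense_le)
      fix y :: real assume y: "y < 1"
      \<comment> \<open>Taking \<open>c\<close> above 0 as well keeps the SINR targets
        \<open>c * g0 l\<close> nonnegative and puts \<open>c\<close> in the range of
        \<open>exp_mult_le\<close>.\<close>
      obtain c where c: "max y 0 < c" "c < 1" using dense[of "max y 0" 1] y by auto
      obtain e where "e \<in> E" "c < e" using less_cSupD[OF E0, of c] E1 c(2) by auto
      then obtain T R p where e: "EFOP_feasible L NT NR M PT T R p" "c \<le> EFOP_obj L M H Phi g0 T R p"
        unfolding E_def by auto
      obtain \<Sigma> where S: "FOP_feasible L NT PT \<Sigma>"
        "\<And>l g. l < L \<Longrightarrow> 0 \<le> g \<Longrightarrow> (\<And>m. m < M l \<Longrightarrow> g \<le> SINR L M H Phi T R p l m) \<Longrightarrow>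
           real (M l) * ln (1 + g) \<le> rate L NR H Phi \<Sigma> l"
        using FOP_of_EFOP[OF e(1)] by blast
      have "c * I0 l \<le> rate L NR H Phi \<Sigma> l" if l: "l < L" for l
      proof -
        have cg: "0 \<le> c * g0 l" using c g0[OF l] by auto
        have "c * x l = ln (exp (c * x l))" by simp
        \<comment> \<open>Convexity of the exponential: scaling a SINR target by \<open>c\<close>
          leaves at least the fraction \<open>c\<close> of the rate.\<close>
        also have "\<dots> \<le> ln (1 + c * g0 l)"
          unfolding g0_def using exp_mult_le[of c "x l"] c cg by (subst ln_le_cancel_iff) (auto simp: g0_def)
        finally have "real (M l) * (c * x l) \<le> real (M l) * ln (1 + c * g0 l)" by (intro mult_left_mono) auto
        also have "\<dots> \<le> rate L NR H Phi \<Sigma> l"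
          using S(2)[OF l cg] e(2) EFOP_ge[of c T R p] l by blast
        finally show ?thesis using M_pos[OF l] by (simp add: x_def)
      qed
      then have "c \<le> FOP_obj L NR H Phi I0 \<Sigma>" using FOP_ge by blast
      also have "\<dots> \<le> Sup F" using S(1) by (intro cSup_upper[OF _ F_bdd]) (auto simp: F_def)
      finally show "y \<le> Sup F" using c by auto
    qed
  qed
  then show ?thesis unfolding FOP_value_def EFOP_value_def F_def E_def g0_def[abs_def] x_def[abs_def] .
qed

end
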